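(* For $m\ge0$ let $\mathfrak v_m$ be the optimal variance in the degree-$m$ polynomial-square problem, $$\mathfrak v_m=\inf_{\deg a=m}\mathcal V(a)=\min_{1\le j<m+2}\frac{(x_{j+1,m+2}-x_{j,m+2})^2}{4x_{j,m+2}x_{j+1,m+2}} .$$ Then, as $m\to\infty$, $$\mathfrak v_m=\frac{\pi^2}{4m^2}+o(m^{-2}),\qquad (2m+1)^2\,\mathfrak v_m\to\pi^2 .$$ Moreover, for every choice of indices $j_m\in\{1,\dots,m+1\}$ attaining the minimum above, $$\frac{x_{j_m,m+2}}{m+2}\to2,\qquad \frac{x_{j_m+1,m+2}}{m+2}\to2,\qquad x_{j_m+1,m+2}-x_{j_m,m+2}\to2\pi,\qquad \frac{j_m}{m+2}\to\frac12+\frac1\pi .$$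
   Context: For a nonzero real polynomial $a$ and $k=0,1,2$ set $Q_k(a)=\int_0^\infty z^k e^{-z}a(z)^2\,dz$ and $\mathcal V(a)=\frac{Q_0(a)Q_2(a)}{Q_1(a)^2}-1$; this is the variance of the mean-one probability density $\kappa_{\lambda,a}(u)=\lambda e^{-\lambda u}a(\lambda u)^2/Q_0(a)$, $u\ge0$, with $\lambda=Q_1(a)/Q_0(a)$. The infimum is over real polynomials $a$ of exact degree $m$. $L_n(t)=\sum_{j=0}^n(-1)^j\binom nj\frac{t^j}{j!}$ is the ordinary Laguerre polynomial, with zeros $0<x_{1,n}<\cdots<x_{n,n}$. *)

theory Defs
  imports
    "HOL-Analysis.Analysis"
    "HOL-Computational_Algebra.Polynomial"
    "HOL-Library.Landau_Symbols"
begin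

definition Q :: "nat \<Rightarrow> real poly \<Rightarrow> real" where
  "Q k a = (LINT z:{0..}|lborel. z ^ k * exp (- z) * (poly a z)\<^sup>2)"

(* The variance of the mean-one density u \<mapsto> \<lambda> exp (- \<lambda> u) a(\<lambda> u)^2 / Q 0 a on [0, \<infinity>), where
   \<lambda> = Q 1 a / Q 0 a. *)
definition \<V> :: "real poly \<Rightarrow> real" where
  "\<V> a = Q 0 a * Q 2 a / (Q 1 a)\<^sup>2 - 1"

(* The condition a \<noteq> 0 only matters for m = 0, since degree 0 = 0 in HOL. *)
definition opt_variance :: "nat \<Rightarrow> real" where
  "opt_variance m = Inf {\<V> a |a. a \<noteq> 0 \<and> degree a = m}"

definition laguerre :: "nat \<Rightarrow> real poly" where
  "laguerre n = (\<Sum>j\<le>n. monom ((- 1) ^ j * real (n choose j) / fact j) j)"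

(* The j-th smallest zero of the n-th Laguerre polynomial, counted from 1; only meaningful for
   1 \<le> j \<le> n.  The zeros are real and simple, so the set of zeros has n elements. *)
definition laguerre_zero :: "nat \<Rightarrow> nat \<Rightarrow> real" where
  "laguerre_zero j n = sorted_list_of_set {t. poly (laguerre n) t = 0} ! (j - 1)"

definition gap_ratio :: "nat \<Rightarrow> nat \<Rightarrow> real" where
  "gap_ratio n j =
     (laguerre_zero (j + 1) n - laguerre_zero j n)\<^sup>2 /
     (4 * laguerre_zero j n * laguerre_zero (j + 1) n)"

end

theory Submission
  imports Defs "HOL-Probability.Distributions" "HOL-Computational_Algebra.Fundamental_Theorem_Algebra"
begin

text \<open>
  With \<open>n = m + 2\<close>, Gauss--Laguerre quadrature at the zeros \<open>x\<^sub>i\<close> of \<open>L\<^sub>n\<close>, whose weights are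
  \<open>1 / (x\<^sub>i L\<^sub>n'(x\<^sub>i)\<^sup>2)\<close>, turns \<open>Q\<^sub>k(a)\<close> into \<open>\<Sum>\<^sub>i c\<^sub>i\<^sup>2 x\<^sub>i\<^sup>k / x\<^sub>i\<close> with \<open>c\<^sub>i = a(x\<^sub>i) / L\<^sub>n'(x\<^sub>i)\<close>;
  the degree bound on \<open>a\<close> becomes the single constraint \<open>\<Sum>\<^sub>i c\<^sub>i = 0\<close>. The optimal \<open>c\<close> is supported
  on two neighbouring zeros: the diagonal quadratic forms \<open>Q\<^sub>2 - (r + 1/r) t Q\<^sub>1 + t\<^sup>2 Q\<^sub>0\<close>, where
  \<open>r\<^sup>2\<close> is the smallest ratio of neighbouring zeros, have at most one negative entry, and they are
  nonnegative on the hyperplane \<open>\<Sum>\<^sub>i c\<^sub>i = 0\<close> by the Cauchy--Schwarz inequality.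

  For the asymptotics, put \<open>x = exp s\<close> in the Laguerre equation. Then \<open>exp (- x / 2) L\<^sub>n x\<close> solves
  \<open>u'' + q u = 0\<close> with \<open>q = \<nu> x - x\<^sup>2 / 4 \<le> \<nu>\<^sup>2\<close>, \<open>\<nu> = n + 1/2\<close>, and equality exactly at \<open>x = 2 \<nu>\<close>.
  By Sturm comparison every logarithmic gap \<open>\<delta>\<close> between zeros satisfies \<open>\<delta>\<^sup>2 q = \<pi>\<^sup>2\<close> at some
  intermediate point, so the smallest gaps are \<open>\<pi> / \<nu>\<close> up to a factor tending to 1, and lie
  near \<open>2 \<nu>\<close>. Summing the gaps on either side counts the zeros there.
\<close>

section \<open>Exponential moments and orthogonality\<close>

text \<open>The integral of exp(-z) p(z) over [0, oo), evaluated termwise by the Gamma integral. In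
  this finite form linearity and integration by parts need no integrability arguments.\<close>

definition exp_moment :: "real poly \<Rightarrow> real" where
  "exp_moment p = (\<Sum>k\<le>degree p. coeff p k * fact k)"

lemma exp_moment_altdef:
  assumes "degree p \<le> d"
  shows "exp_moment p = (\<Sum>k\<le>d. coeff p k * fact k)"
  unfolding exp_moment_def
  using assms by (intro sum.mono_neutral_left) (auto simp: coeff_eq_0)

lemma exp_moment_0 [simp]: "exp_moment 0 = 0"
  by (simp add: exp_moment_def)

lemma exp_moment_add: "exp_moment (p + q) = exp_moment p + exp_moment q"
proof -
  define d where "d = max (degree p) (degree q)"
  have "degree p \<le> d" "degree q \<le> d" "degree (p + q) \<le> d"
    by (auto simp: d_def degree_add_le)
  then show ?thesis
    by (simp add: exp_moment_altdef[of _ d] sum.distrib algebra_simps)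
qed

lemma exp_moment_smult: "exp_moment (smult c p) = c * exp_moment p"
  by (simp add: exp_moment_altdef[of "smult c p" "degree p"] exp_moment_def sum_distrib_left mult_ac
      degree_smult_le)

lemma exp_moment_diff: "exp_moment (p - q) = exp_moment p - exp_moment q"
  using exp_moment_add[of p "smult (-1) q"] exp_moment_smult[of "-1" q] by simp

lemma exp_moment_sum: "exp_moment (\<Sum>i\<in>A. f i) = (\<Sum>i\<in>A. exp_moment (f i))"
  by (induction A rule: infinite_finite_induct) (auto simp: exp_moment_add)

text \<open>Integration by parts, with boundary term p(0). On coefficients it is an index shift, as
  (k + 1) k! = (k + 1)!.\<close>

lemma exp_moment_pderiv: "exp_moment (pderiv p) = exp_moment p - coeff p 0"
proof (cases "degree p")
  case 0
  then show ?thesis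
    by (auto elim!: degree_eq_zeroE simp: exp_moment_def)
next
  case (Suc d)
  have "exp_moment p = coeff p 0 + (\<Sum>k\<le>d. coeff p (Suc k) * fact (Suc k))"
    unfolding exp_moment_def Suc by (subst sum.atMost_Suc_shift) simp
  also have "(\<Sum>k\<le>d. coeff p (Suc k) * fact (Suc k)) = exp_moment (pderiv p)"
    using Suc by (simp add: exp_moment_def degree_pderiv coeff_pderiv mult_ac)
  finally show ?thesis by simp
qed

lemma has_bochner_integral_power_exp:
  "has_bochner_integral lborel (\<lambda>z::real. indicator {0..} z *\<^sub>R (z ^ k * exp (- z))) (fact k)"
proof (rule has_bochner_integral_nn_integral)
  show "(\<integral>\<^sup>+z. ennreal (indicator {0..} z *\<^sub>R (z ^ k * exp (- z))) \<partial>lborel) = ennreal (fact k)"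
  proof -
    have "(\<integral>\<^sup>+z. ennreal (indicator {0..} z *\<^sub>R (z ^ k * exp (- z))) \<partial>lborel)
        = (\<integral>\<^sup>+z. ennreal (z ^ k * exp (- z)) * indicator {0..} z \<partial>lborel)"
      by (intro nn_integral_cong) (simp add: indicator_def)
    then show ?thesis
      by (simp add: nn_intergal_power_times_exp_Ici)
  qed
qed (auto simp: indicator_def)

lemma has_bochner_integral_poly_exp:
  "has_bochner_integral lborel (\<lambda>z. indicator {0..} z *\<^sub>R (exp (- z) * poly p z)) (exp_moment p)"
proof -
  have "has_bochner_integral lborel
     (\<lambda>z. \<Sum>k\<le>degree p. coeff p k * (indicator {0..} z *\<^sub>R (z ^ k * exp (- z))))
     (\<Sum>k\<le>degree p. coeff p k * fact k)"
    by (intro has_bochner_integral_sum has_bochner_integral_mult_right has_bochner_integral_power_exp)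
  then show ?thesis
    by (simp add: exp_moment_def poly_altdef sum_distrib_left mult_ac)
qed

text \<open>A nonnegative integrand with integral 0 vanishes almost everywhere, but \<open>p\<close>
  has finitely many zeros, so \<open>{0..1}\<close> would be a null set.\<close>

lemma exp_moment_pos:
  assumes "p \<noteq> 0" and nonneg: "\<And>z. z \<ge> 0 \<Longrightarrow> poly p z \<ge> 0"
  shows "exp_moment p > 0"
proof -
  define f where "f = (\<lambda>z. indicator {0..} z *\<^sub>R (exp (- z) * poly p z))"
  have int: "has_bochner_integral lborel f (exp_moment p)"
    unfolding f_def by (rule has_bochner_integral_poly_exp)
  have f0: "f z \<ge> 0" for z
    using nonneg by (auto simp: f_def indicator_def)
  have "exp_moment p \<ge> 0"
    using int f0 Bochner_Integration.integral_nonneg[of lborel f]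
    by (auto simp: has_bochner_integral_iff)
  moreover have "exp_moment p \<noteq> 0"
  proof
    assume "exp_moment p = 0"
    then have "AE z in lborel. f z = 0"
      using int f0 integral_nonneg_eq_0_iff_AE[of lborel f]
      by (auto simp: has_bochner_integral_iff)
    moreover have "AE z in lborel. z \<notin> {z. poly p z = 0}"
      using poly_roots_finite[OF \<open>p \<noteq> 0\<close>]
      by (intro AE_not_in) (auto intro!: null_setsI finite_imp_null_set_lborel)
    ultimately have "AE z in lborel. z \<notin> {0..1::real}"
      by eventually_elim (auto simp: f_def)
    then have "emeasure lborel {0..1::real} = 0"
      by (subst (asm) AE_iff_measurable[of "{0..1}"]) auto
    then show False by simp
  qed
  ultimately show ?thesis by simp
qed

lemma Q_eq_exp_moment: "Q k a = exp_moment (monom 1 k * a\<^sup>2)"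
proof -
  have "Q k a = (LINT z|lborel. indicator {0..} z *\<^sub>R (exp (- z) * poly (monom 1 k * a\<^sup>2) z))"
    by (simp add: Q_def set_lebesgue_integral_def poly_monom mult_ac)
  also have "\<dots> = exp_moment (monom 1 k * a\<^sup>2)"
    by (rule has_bochner_integral_integral_eq[OF has_bochner_integral_poly_exp])
  finally show ?thesis .
qed

section \<open>Laguerre polynomials: differential equation and orthogonality\<close>

lemma coeff_laguerre: "coeff (laguerre n) j = (- 1) ^ j * real (n choose j) / fact j"
  by (simp add: laguerre_def coeff_sum coeff_monom binomial_eq_0)

lemma degree_laguerre [simp]: "degree (laguerre n) = n"
  by (intro antisym degree_le le_degree) (auto simp: coeff_laguerre binomial_eq_0)

lemma laguerre_neq_0 [simp]: "laguerre n \<noteq> 0"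
proof -
  have "coeff (laguerre n) n \<noteq> 0"
    by (simp add: coeff_laguerre)
  then show ?thesis by auto
qed

lemma poly_laguerre_0 [simp]: "poly (laguerre n) 0 = 1"
  by (simp add: poly_0_coeff_0 coeff_laguerre)

text \<open>Pascal's rule on the coefficients. This relation drives the induction for
  orthogonality.\<close>

lemma pderiv_laguerre_diff: "pderiv (laguerre (Suc n) - laguerre n) = - laguerre n"
proof (rule poly_eqI)
  fix j
  have "real (Suc n choose Suc j) - real (n choose Suc j) = real (n choose j)"
    by simp
  then show "coeff (pderiv (laguerre (Suc n) - laguerre n)) j = coeff (- laguerre n) j"
    unfolding coeff_pderiv coeff_diff coeff_minus coeff_laguerre
    by (simp add: divide_simps) (simp add: algebra_simps)
qed

text \<open>Read at degree j, the equation is the two-term recurrence (j + 1)^2 c_{j+1} = -(n - j)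
  c_j, which is binomial absorption.\<close>

lemma laguerre_ode:
  "[:0, 1:] * pderiv (pderiv (laguerre n)) + [:1, -1:] * pderiv (laguerre n)
    + smult (real n) (laguerre n) = 0"
proof (rule poly_eqI)
  fix j
  have *: "real (Suc j) * real (n choose Suc j) = (real n - real j) * real (n choose j)"
  proof (cases "j \<le> n")
    case True
    have "Suc j * (n choose Suc j) = (n - j) * (n choose j)"
      by (simp only: binomial_absorb_comp binomial_absorption)
    then have "real (Suc j * (n choose Suc j)) = real ((n - j) * (n choose j))"
      by (simp only:)
    then show ?thesis using True by (simp only: of_nat_mult of_nat_diff)
  qed (simp add: binomial_eq_0)
  have c: "real (Suc j) * real (Suc j) * coeff (laguerre n) (Suc j)
            = - (real n - real j) * coeff (laguerre n) j"
  proof -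
    have "real (Suc j) * real (Suc j) * coeff (laguerre n) (Suc j)
        = (- 1) ^ Suc j * (real (Suc j) * real (n choose Suc j)) / fact j"
      by (simp add: coeff_laguerre field_simps del: of_nat_Suc)
    also have "\<dots> = - (real n - real j) * coeff (laguerre n) j"
      unfolding * coeff_laguerre power_Suc
      by (simp only: divide_inverse mult_minus_left mult_minus_right mult_1_left mult_ac)
    finally show ?thesis .
  qed
  show "coeff ([:0, 1:] * pderiv (pderiv (laguerre n)) + [:1, -1:] * pderiv (laguerre n)
    + smult (real n) (laguerre n)) j = coeff 0 j"
    using c by (cases j) (simp_all add: coeff_pderiv algebra_simps)
qed

text \<open>Integrate z^k D by parts with D = L_n - L_{n-1} and D' = -L_{n-1}. The boundary term
  vanishes because D(0) = 0, and the moments of L_{n-1} of order k cancel, so the k-th moment of L_n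
  reduces to moments of order k - 1.\<close>

lemma exp_moment_monom_laguerre:
  assumes "k < n"
  shows "exp_moment (monom 1 k * laguerre n) = 0"
  using assms
proof (induction k arbitrary: n)
  case 0
  obtain n' where n: "n = Suc n'" using 0 by (cases n) auto
  define D where "D = laguerre n - laguerre n'"
  have "exp_moment (pderiv D) = exp_moment D"
    by (simp add: exp_moment_pderiv D_def coeff_laguerre)
  then have "- exp_moment (laguerre n') = exp_moment (laguerre n) - exp_moment (laguerre n')"
    unfolding D_def n pderiv_laguerre_diff by (simp add: exp_moment_diff exp_moment_diff[of 0, simplified])
  then show ?case by (simp add: monom_0)
next
  case (Suc k)
  obtain n' where n: "n = Suc n'" using Suc by (cases n) auto
  define D where "D = laguerre n - laguerre n'"
  have m: "pderiv (monom (1::real) (Suc k)) = smult (real (Suc k)) (monom 1 k)"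
    by (simp add: pderiv_monom smult_monom)
  have "pderiv (monom 1 (Suc k) * D)
      = smult (real (Suc k)) (monom 1 k * D) - monom 1 (Suc k) * laguerre n'"
    unfolding pderiv_mult m D_def n pderiv_laguerre_diff
    by (simp only: mult_smult_right mult_minus_right uminus_add_conv_diff
        mult.commute[of "laguerre (Suc n') - laguerre n'"])
  then have "exp_moment (monom 1 (Suc k) * D) =
     real (Suc k) * exp_moment (monom 1 k * D) - exp_moment (monom 1 (Suc k) * laguerre n')"
    using exp_moment_pderiv[of "monom 1 (Suc k) * D"]
    by (simp add: exp_moment_diff exp_moment_smult coeff_mult)
  moreover have "exp_moment (monom 1 k * D) = 0"
    using Suc.IH[of n] Suc.IH[of n'] Suc.prems n
    by (simp add: D_def algebra_simps exp_moment_diff)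
  ultimately show ?case
    by (simp add: D_def right_diff_distrib exp_moment_diff)
qed

lemma exp_moment_laguerre_mult:
  assumes "degree p < n"
  shows "exp_moment (laguerre n * p) = 0"
proof -
  have "laguerre n * p = (\<Sum>i\<le>degree p. smult (coeff p i) (monom 1 i * laguerre n))"
  proof -
    have "p = (\<Sum>i\<le>degree p. smult (coeff p i) (monom 1 i))"
      by (simp add: smult_monom poly_as_sum_of_monoms)
    then have "laguerre n * p = laguerre n * (\<Sum>i\<le>degree p. smult (coeff p i) (monom 1 i))"
      by simp
    then show ?thesis
      by (simp only: sum_distrib_left mult_smult_right mult.commute[of "laguerre n"])
  qed
  then show ?thesis
    using assms by (simp add: exp_moment_sum exp_moment_smult exp_moment_monom_laguerre)
qed

section \<open>Zeros and Gauss--Laguerre quadrature\<close>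

text \<open>\<open>g\<close> has degree below n, so orthogonality gives q g^2 integral 0, against
  positivity. Taking for \<open>q\<close> a linear factor with nonpositive root, a squared linear
  factor or a quadratic without real roots makes all zeros positive, simple and real.\<close>

lemma laguerre_nonneg_factor:
  assumes L: "laguerre n = q * g" and q: "degree q > 0" "\<And>z. z \<ge> 0 \<Longrightarrow> poly q z \<ge> 0"
  shows False
proof -
  have "q \<noteq> 0" "g \<noteq> 0"
    using laguerre_neq_0[of n] unfolding L by auto
  then have "degree g < n"
    using q degree_mult_eq[of q g] degree_laguerre[of n] by (simp flip: L)
  then have "exp_moment (q * g * g) = 0"
    using exp_moment_laguerre_mult[of g n] by (simp add: L)
  moreover have "exp_moment (q * g * g) > 0"
    using \<open>q \<noteq> 0\<close> \<open>g \<noteq> 0\<close> q by (intro exp_moment_pos) (auto simp: mult.assoc)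
  ultimately show False by simp
qed

lemma laguerre_root_pos:
  assumes "poly (laguerre n) t = 0"
  shows "t > 0"
proof (rule ccontr)
  assume "\<not> t > 0"
  obtain g where "laguerre n = [:-t, 1:] * g"
    using assms unfolding poly_eq_0_iff_dvd by (auto elim: dvdE)
  then show False
    by (rule laguerre_nonneg_factor) (use \<open>\<not> t > 0\<close> in auto)
qed

lemma laguerre_not_square_dvd: "\<not> [:-t, 1:] ^ 2 dvd laguerre n"
proof
  assume "[:-t, 1:] ^ 2 dvd laguerre n"
  then obtain g where "laguerre n = [:-t, 1:] ^ 2 * g" ..
  then show False
    by (rule laguerre_nonneg_factor) (auto simp: degree_power_eq)
qed

lemma pderiv_laguerre_root_neq_0:
  assumes "poly (laguerre n) t = 0"
  shows "poly (pderiv (laguerre n)) t \<noteq> 0"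
proof
  assume *: "poly (pderiv (laguerre n)) t = 0"
  obtain g where g: "laguerre n = [:-t, 1:] * g"
    using assms unfolding poly_eq_0_iff_dvd by (auto elim: dvdE)
  have "poly g t = 0"
    using * unfolding g pderiv_mult by (simp add: pderiv_pCons)
  then obtain g' where "g = [:-t, 1:] * g'"
    unfolding poly_eq_0_iff_dvd by (auto elim: dvdE)
  then show False
    using g laguerre_not_square_dvd[of t n] by (metis dvd_triv_left power2_eq_square mult.assoc)
qed

lemma prod_linear_factors_dvd:
  fixes p :: "'a :: idom poly"
  assumes "finite A" "\<And>a. a \<in> A \<Longrightarrow> poly p a = 0"
  shows "(\<Prod>a\<in>A. [:-a, 1:]) dvd p"
  using assms
proof (induction A rule: finite_induct)
  case (insert a A)
  then obtain g where g: "p = (\<Prod>a\<in>A. [:-a, 1:]) * g"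
    by (auto elim: dvdE)
  have "poly (\<Prod>a\<in>A. [:-a, 1:]) a \<noteq> 0"
    using insert.hyps by (auto simp: poly_prod)
  moreover have "poly p a = 0"
    using insert.prems by simp
  ultimately have "[:-a, 1:] dvd g"
    unfolding g by (simp add: poly_eq_0_iff_dvd)
  then show ?case
    using insert.hyps unfolding g
    by (subst prod.insert) (simp_all add: mult.commute[of _ g] mult_dvd_mono del: mult_pCons_left)
qed simp

lemma map_poly_of_real_add:
  "map_poly complex_of_real (p + q) = map_poly complex_of_real p + map_poly complex_of_real q"
  by (intro poly_eqI) (simp add: coeff_map_poly)

lemma map_poly_of_real_mult:
  "map_poly complex_of_real (p * q) = map_poly complex_of_real p * map_poly complex_of_real q"
  by (intro poly_eqI) (simp add: coeff_map_poly coeff_mult)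

lemma poly_map_poly_of_real:
  "poly (map_poly complex_of_real p) (complex_of_real x) = complex_of_real (poly p x)"
  by (induction p) (simp_all add: map_poly_pCons)

text \<open>The remainder modulo the quadratic with roots z and its conjugate is a real polynomial
  of degree at most 1 that vanishes at the nonreal z, hence it is 0.\<close>

lemma real_poly_complex_root_dvd:
  fixes p :: "real poly"
  assumes "poly (map_poly complex_of_real p) z = 0" "Im z \<noteq> 0"
  shows "[:(Re z)\<^sup>2 + (Im z)\<^sup>2, - 2 * Re z, 1:] dvd p"
proof -
  define q where "q = [:(Re z)\<^sup>2 + (Im z)\<^sup>2, - 2 * Re z, 1:]"
  define r where "r = p mod q"
  have "degree r < 2"
    using degree_mod_less'[of q p] by (cases "r = 0") (auto simp: r_def q_def)
  then have "r = [:coeff r 0, coeff r 1:]"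
    by (intro poly_eqI) (auto simp: coeff_pCons coeff_eq_0 split: nat.splits)
  then obtain a b where r: "r = [:a, b:]"
    by blast
  have qz: "poly (map_poly complex_of_real q) z = 0"
    by (simp add: q_def map_poly_pCons complex_eq_iff power2_eq_square algebra_simps)
  have "p = q * (p div q) + r"
    by (simp add: r_def)
  then have "poly (map_poly complex_of_real p) z = 
      poly (map_poly complex_of_real q) z * poly (map_poly complex_of_real (p div q)) z
      + poly (map_poly complex_of_real r) z"
    by (metis map_poly_of_real_add map_poly_of_real_mult poly_mult poly_add)
  then have "poly (map_poly complex_of_real r) z = 0"
    using qz assms by simp
  then have "r = 0"
    using assms(2) by (auto simp: r map_poly_pCons complex_eq_iff)
  then show ?thesis
    by (simp add: r_def q_def mod_eq_0_iff_dvd)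
qed

text \<open>Divide out the real zeros. A nonconstant quotient would have a complex zero: a real one
  would be a double zero of L_n, a nonreal one would give a nonnegative quadratic factor. Both are
  excluded.\<close>

lemma card_laguerre_roots: "card {t. poly (laguerre n) t = 0} = n"
proof -
  define R where "R = {t. poly (laguerre n) t = 0}"
  define P where "P = (\<Prod>t\<in>R. [:-t, 1:])"
  have fin: "finite R"
    by (simp add: R_def poly_roots_finite)
  have "P dvd laguerre n"
    unfolding P_def using fin by (rule prod_linear_factors_dvd) (simp add: R_def)
  then obtain g where g: "laguerre n = P * g" ..
  have "degree g = 0"
  proof (rule ccontr)
    assume "degree g \<noteq> 0"
    then have "\<not> constant (poly (map_poly complex_of_real g))"
      by (simp add: constant_degree degree_map_poly)
    then obtain z where z: "poly (map_poly complex_of_real g) z = 0"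
      using fundamental_theorem_of_algebra by blast
    show False
    proof (cases "Im z = 0")
      case True
      define t where "t = Re z"
      have "z = complex_of_real t"
        using True by (simp add: complex_eq_iff t_def)
      then have "poly g t = 0"
        using z by (simp add: poly_map_poly_of_real)
      then have "t \<in> R" "[:-t, 1:] dvd g"
        by (simp_all add: R_def g poly_eq_0_iff_dvd)
      moreover have "[:-t, 1:] dvd P"
        unfolding P_def using fin \<open>t \<in> R\<close> by (rule dvd_prodI)
      ultimately show False
        using laguerre_not_square_dvd[of t n]
        unfolding g power2_eq_square by (metis mult_dvd_mono)
    next
      case False
      define q where "q = [:(Re z)\<^sup>2 + (Im z)\<^sup>2, - 2 * Re z, 1:]"
      have "q dvd laguerre n"
        unfolding g q_def by (intro dvd_mult real_poly_complex_root_dvd z False)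
      then obtain h where h: "laguerre n = q * h" ..
      have "poly q x = (x - Re z)\<^sup>2 + (Im z)\<^sup>2" for x
        by (simp add: q_def power2_eq_square algebra_simps)
      then have "poly q x \<ge> 0" for x
        by simp
      with h show False
        by (intro laguerre_nonneg_factor[of n q h]) (simp_all add: q_def)
    qed
  qed
  moreover have "degree P = card R"
    unfolding P_def by (subst degree_prod_eq_sum_degree) auto
  moreover have "P \<noteq> 0" "g \<noteq> 0"
    using laguerre_neq_0[of n] unfolding g by auto
  ultimately have "n = card R"
    using degree_mult_eq[of P g] by (simp flip: g)
  then show ?thesis by (simp add: R_def)
qed

section \<open>Interpolation at the zeros and the quadrature weights\<close>

abbreviation laguerre_roots :: "nat \<Rightarrow> real set" where
  "laguerre_roots n \<equiv> {t. poly (laguerre n) t = 0}"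

lemma finite_laguerre_roots [simp]: "finite (laguerre_roots n)"
  by (simp add: poly_roots_finite)

text \<open>At a zero \<open>t\<close> this is L_n(z) / (z - t), a Lagrange basis polynomial up to
  normalisation.\<close>

definition laguerre_cofactor :: "nat \<Rightarrow> real \<Rightarrow> real poly" where
  "laguerre_cofactor n t = synthetic_div (laguerre n) t"

lemma laguerre_cofactor:
  assumes "poly (laguerre n) t = 0"
  shows "laguerre n = [:-t, 1:] * laguerre_cofactor n t"
  using synthetic_div_correct'[of t "laguerre n"] assms by (simp add: laguerre_cofactor_def)

lemma degree_laguerre_cofactor: "degree (laguerre_cofactor n t) = n - 1"
  by (simp add: laguerre_cofactor_def degree_synthetic_div)

lemma poly_laguerre_cofactor_same:
  assumes "poly (laguerre n) t = 0"
  shows "poly (laguerre_cofactor n t) t = poly (pderiv (laguerre n)) t"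
  by (subst laguerre_cofactor[OF assms]) (simp add: pderiv_mult pderiv_pCons del: mult_pCons_left)

lemma poly_laguerre_cofactor_other:
  assumes "poly (laguerre n) t = 0" "poly (laguerre n) s = 0" "s \<noteq> t"
  shows "poly (laguerre_cofactor n t) s = 0"
  using assms(2,3) by (subst (asm) laguerre_cofactor[OF assms(1)]) auto

lemma laguerre_interpolation:
  assumes "degree r < n"
  shows "r = (\<Sum>t\<in>laguerre_roots n.
    smult (poly r t / poly (pderiv (laguerre n)) t) (laguerre_cofactor n t))" (is "r = ?s")
proof (rule poly_eqI_degree)
  show "poly r u = poly ?s u" if "u \<in> laguerre_roots n" for u
  proof -
    have "poly ?s u = (\<Sum>t\<in>laguerre_roots n. if t = u then poly r u else 0)"
      unfolding poly_sum poly_smult using that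
      by (intro sum.cong) (auto simp: poly_laguerre_cofactor_same poly_laguerre_cofactor_other
          pderiv_laguerre_root_neq_0)
    then show ?thesis using that by simp
  qed
  show "degree r < card (laguerre_roots n)"
    using assms by (simp add: card_laguerre_roots)
  have "degree ?s \<le> n - 1"
    by (intro degree_sum_le order.trans[OF degree_smult_le]) (auto simp: degree_laguerre_cofactor)
  then show "degree ?s < card (laguerre_roots n)"
    using assms by (simp add: card_laguerre_roots)
qed

text \<open>Compare coefficients of degree n - 1 in the interpolation formula: every cofactor has
  the leading coefficient of L_n, while that of \<open>a\<close> is 0. This is the linear constraint
  of the optimisation.\<close>

lemma laguerre_divided_difference_eq_0:
  assumes "degree a + 2 \<le> n"
  shows "(\<Sum>t\<in>laguerre_roots n. poly a t / poly (pderiv (laguerre n)) t) = 0"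
proof -
  obtain n' where n: "n = Suc n'" using assms by (cases n) auto
  have lc: "coeff (laguerre_cofactor n t) n' = coeff (laguerre n) n"
    if "poly (laguerre n) t = 0" for t
    using arg_cong[OF laguerre_cofactor[OF that], of "\<lambda>p. coeff p n"] degree_laguerre_cofactor[of n t]
    by (simp add: n coeff_eq_0)
  have "0 = coeff a n'"
    using assms n by (simp add: coeff_eq_0)
  also have "\<dots> = (\<Sum>t\<in>laguerre_roots n.
      poly a t / poly (pderiv (laguerre n)) t * coeff (laguerre_cofactor n t) n')"
    using assms by (subst laguerre_interpolation[of a n]) (auto simp: coeff_sum)
  also have "\<dots> = (\<Sum>t\<in>laguerre_roots n. poly a t / poly (pderiv (laguerre n)) t)
      * coeff (laguerre n) n"
    by (simp add: lc sum_distrib_right)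
  finally show ?thesis
    by (simp add: coeff_laguerre)
qed

text \<open>With L_n = (z - t) l, the derivative of L_n l is l^2 + 2 L_n l', and orthogonality
  removes the second term. What remains is the boundary value -l(0), and 1 = L_n(0) = -t
  l(0).\<close>

lemma exp_moment_laguerre_cofactor_square:
  assumes t: "poly (laguerre n) t = 0"
  shows "exp_moment ((laguerre_cofactor n t)\<^sup>2) = 1 / t"
proof -
  define l where "l = laguerre_cofactor n t"
  have L: "laguerre n = [:-t, 1:] * l"
    unfolding l_def by (rule laguerre_cofactor[OF t])
  have "n > 0"
    using t by (cases n) (auto simp: laguerre_def)
  then have deg: "degree l < n" "degree (pderiv l) < n"
    by (auto simp: l_def degree_laguerre_cofactor degree_pderiv)
  have "pderiv (laguerre n * l) = l\<^sup>2 + (laguerre n * pderiv l + laguerre n * pderiv l)"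
  proof -
    have "pderiv (laguerre n) = l + [:-t, 1:] * pderiv l"
      unfolding L by (simp add: pderiv_mult pderiv_pCons del: mult_pCons_left)
    moreover have "l * ([:-t, 1:] * pderiv l) = laguerre n * pderiv l"
      by (simp add: L del: mult_pCons_left mult_pCons_right)
    ultimately show ?thesis
      by (simp add: pderiv_mult power2_eq_square distrib_left distrib_right)
  qed
  then have "exp_moment (l\<^sup>2) = exp_moment (pderiv (laguerre n * l))"
    using deg by (simp only: exp_moment_add exp_moment_laguerre_mult)
  also have "\<dots> = - poly l 0"
    using deg by (simp add: exp_moment_pderiv exp_moment_laguerre_mult poly_mult flip: poly_0_coeff_0)
  also have "\<dots> = 1 / t"
    using arg_cong[OF L, of "\<lambda>p. poly p 0"] laguerre_root_pos[OF t]
    by (simp add: field_simps)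
  finally show ?thesis by (simp add: l_def)
qed

text \<open>Division by L_n leaves a quotient of degree below n, to which L_n is orthogonal, so
  interpolation is exact up to degree 2n - 1. Testing the rule on the square of one cofactor
  isolates one node and gives its weight.\<close>

theorem gauss_laguerre_quadrature:
  assumes "degree p < 2 * n"
  shows "exp_moment p
    = (\<Sum>t\<in>laguerre_roots n. poly p t / (t * (poly (pderiv (laguerre n)) t)\<^sup>2))"
proof -
  define w where "w = (\<lambda>t. exp_moment (laguerre_cofactor n t) / poly (pderiv (laguerre n)) t)"
  have quad: "exp_moment p = (\<Sum>t\<in>laguerre_roots n. w t * poly p t)" if "degree p < 2 * n" for p
  proof -
    define r where "r = p mod laguerre n"
    have p: "p = laguerre n * (p div laguerre n) + r"
      by (simp add: r_def)
    have "n > 0" using that by (cases n) auto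
    then have r: "degree r < n"
      using degree_mod_less[of "laguerre n" p] by (auto simp: r_def)
    have "degree (laguerre n * (p div laguerre n)) < 2 * n"
      using that r by (simp add: r_def degree_diff_less flip: minus_mod_eq_mult_div)
    then have "degree (p div laguerre n) < n"
      using \<open>n > 0\<close> by (cases "p div laguerre n = 0") (auto simp: degree_mult_eq)
    then have "exp_moment p = exp_moment r"
      by (subst p) (simp add: exp_moment_add exp_moment_laguerre_mult)
    also have "\<dots> = (\<Sum>t\<in>laguerre_roots n. w t * poly r t)"
      by (subst laguerre_interpolation[OF r])
        (simp add: exp_moment_sum exp_moment_smult w_def mult.commute)
    also have "\<dots> = (\<Sum>t\<in>laguerre_roots n. w t * poly p t)"
      by (intro sum.cong refl) (subst p, simp)
    finally show ?thesis .
  qed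
  have w: "w t = 1 / (t * (poly (pderiv (laguerre n)) t)\<^sup>2)" if t: "t \<in> laguerre_roots n" for t
  proof -
    have "degree ((laguerre_cofactor n t)\<^sup>2) < 2 * n"
      using assms by (intro le_less_trans[OF degree_power_le]) (auto simp: degree_laguerre_cofactor)
    from quad[OF this] have "1 / t = (\<Sum>s\<in>laguerre_roots n. w s * (poly (laguerre_cofactor n t) s)\<^sup>2)"
      using t by (simp add: exp_moment_laguerre_cofactor_square)
    also have "\<dots> = (\<Sum>s\<in>laguerre_roots n. if s = t then w t * (poly (pderiv (laguerre n)) t)\<^sup>2 else 0)"
      using t
      by (intro sum.cong) (auto simp: poly_laguerre_cofactor_same poly_laguerre_cofactor_other)
    also have "\<dots> = w t * (poly (pderiv (laguerre n)) t)\<^sup>2"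
      using t by simp
    finally show ?thesis
      using t laguerre_root_pos[of n t] pderiv_laguerre_root_neq_0[of n t]
      by (simp add: field_simps)
  qed
  show ?thesis
    unfolding quad[OF assms] by (intro sum.cong) (auto simp: w)
qed

text \<open>The integrand polynomial has degree at most 2 + 2 (n - 2) = 2n - 2, within the range of
  exactness.\<close>

lemma Q_eq_sum_laguerre_roots:
  assumes "degree a + 2 \<le> n" "k \<le> 2"
  shows "Q k a = (\<Sum>t\<in>laguerre_roots n. t ^ k / t * (poly a t / poly (pderiv (laguerre n)) t)\<^sup>2)"
proof -
  have "degree (monom 1 k * a\<^sup>2) \<le> k + 2 * degree a"
    using degree_mult_le[of "monom 1 k" "a\<^sup>2"] degree_power_le[of a 2]
    by (simp add: degree_monom_eq)
  then have "degree (monom 1 k * a\<^sup>2) < 2 * n"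
    using assms by linarith
  then show ?thesis
    unfolding Q_eq_exp_moment
    by (subst gauss_laguerre_quadrature) (auto simp: poly_monom power_divide intro!: sum.cong)
qed

section \<open>The optimal variance\<close>

lemma laguerre_zero_less:
  assumes "1 \<le> i" "i < j" "j \<le> n"
  shows "laguerre_zero i n < laguerre_zero j n"
  unfolding laguerre_zero_def using assms
  by (intro sorted_wrt_nth_less[of "(<)"]) (auto simp: card_laguerre_roots)

lemma bij_betw_laguerre_zero: "bij_betw (\<lambda>j. laguerre_zero j n) {1..n} (laguerre_roots n)"
proof (rule bij_betwI')
  fix i j assume "i \<in> {1..n}" "j \<in> {1..n}"
  then show "laguerre_zero i n = laguerre_zero j n \<longleftrightarrow> i = j"
    using laguerre_zero_less[of i j n] laguerre_zero_less[of j i n]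
    by (cases i j rule: linorder_cases) auto
next
  fix i assume i: "i \<in> {1..n}"
  have "sorted_list_of_set (laguerre_roots n) ! (i - 1) \<in> set (sorted_list_of_set (laguerre_roots n))"
    using i by (intro nth_mem) (auto simp: card_laguerre_roots)
  then show "laguerre_zero i n \<in> laguerre_roots n"
    by (simp add: laguerre_zero_def)
next
  fix t assume "t \<in> laguerre_roots n"
  then have "t \<in> set (sorted_list_of_set (laguerre_roots n))"
    by simp
  then obtain i where "i < n" "t = sorted_list_of_set (laguerre_roots n) ! i"
    unfolding in_set_conv_nth by (auto simp: card_laguerre_roots)
  then show "\<exists>j\<in>{1..n}. t = laguerre_zero j n"
    by (intro bexI[of _ "Suc i"]) (auto simp: laguerre_zero_def)
qed

lemma poly_laguerre_zero:
  assumes "1 \<le> j" "j \<le> n"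
  shows "poly (laguerre n) (laguerre_zero j n) = 0"
  using bij_betwE[OF bij_betw_laguerre_zero[of n]] assms by auto

lemma laguerre_zero_pos: "1 \<le> j \<Longrightarrow> j \<le> n \<Longrightarrow> laguerre_zero j n > 0"
  by (rule laguerre_root_pos) (rule poly_laguerre_zero)

lemma laguerre_root_obtain_index:
  assumes "poly (laguerre n) t = 0"
  obtains j where "1 \<le> j" "j \<le> n" "t = laguerre_zero j n"
proof -
  have "t \<in> (\<lambda>j. laguerre_zero j n) ` {1..n}"
    using assms unfolding bij_betw_imp_surj_on[OF bij_betw_laguerre_zero[of n]] by simp
  then show ?thesis using that by auto
qed

lemma laguerre_zero_le_iff:
  assumes "1 \<le> i" "i \<le> n" "1 \<le> j" "j \<le> n"
  shows "laguerre_zero i n \<le> laguerre_zero j n \<longleftrightarrow> i \<le> j"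
  using assms laguerre_zero_less[of i j n] laguerre_zero_less[of j i n]
  by (cases i j rule: linorder_cases) auto

lemma laguerre_zero_less_iff:
  assumes "1 \<le> i" "i \<le> n" "1 \<le> j" "j \<le> n"
  shows "laguerre_zero i n < laguerre_zero j n \<longleftrightarrow> i < j"
  using laguerre_zero_le_iff[of j n i] assms by (simp flip: not_le)

lemma poly_laguerre_neq_0_between:
  assumes "1 \<le> j" "j < n" "laguerre_zero j n < t" "t < laguerre_zero (j + 1) n"
  shows "poly (laguerre n) t \<noteq> 0"
proof
  assume "poly (laguerre n) t = 0"
  then obtain i where "1 \<le> i" "i \<le> n" "t = laguerre_zero i n"
    by (rule laguerre_root_obtain_index)
  then show False
    using assms by (auto simp: laguerre_zero_less_iff)
qed

lemma Q_eq_sum_laguerre_zero: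
  assumes "degree a + 2 \<le> n" "k \<le> 2"
  shows "Q k a = (\<Sum>j=1..n. laguerre_zero j n ^ k / laguerre_zero j n *
    (poly a (laguerre_zero j n) / poly (pderiv (laguerre n)) (laguerre_zero j n))\<^sup>2)"
  unfolding Q_eq_sum_laguerre_roots[OF assms]
  by (rule sum.reindex_bij_betw[OF bij_betw_laguerre_zero, symmetric])

lemma laguerre_zero_divided_difference_eq_0:
  assumes "degree a + 2 \<le> n"
  shows "(\<Sum>j=1..n. poly a (laguerre_zero j n) /
    poly (pderiv (laguerre n)) (laguerre_zero j n)) = 0"
  using laguerre_divided_difference_eq_0[OF assms]
  by (subst sum.reindex_bij_betw[OF bij_betw_laguerre_zero])

section \<open>Lower bound for the variance\<close>

lemma sum_square_le_weighted:
  fixes c e :: "'a \<Rightarrow> real"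
  assumes "\<And>i. i \<in> A \<Longrightarrow> e i > 0"
  shows "(\<Sum>i\<in>A. c i)\<^sup>2 \<le> (\<Sum>i\<in>A. (c i)\<^sup>2 / e i) * (\<Sum>i\<in>A. e i)"
proof -
  have "(\<Sum>i\<in>A. c i)\<^sup>2 = (\<Sum>i\<in>A. (c i / sqrt (e i)) * sqrt (e i))\<^sup>2"
    using assms by (intro arg_cong[of _ _ "\<lambda>x. x\<^sup>2"] sum.cong) force+
  also have "\<dots> \<le> (\<Sum>i\<in>A. (c i / sqrt (e i))\<^sup>2) * (\<Sum>i\<in>A. (sqrt (e i))\<^sup>2)"
    by (rule Cauchy_Schwarz_ineq_sum)
  also have "\<dots> = (\<Sum>i\<in>A. (c i)\<^sup>2 / e i) * (\<Sum>i\<in>A. e i)"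
    using assms by (intro arg_cong2[of _ _ _ _ "(*)"] sum.cong)
      (auto simp: power_divide less_imp_le)
  finally show ?thesis .
qed

text \<open>The reciprocals of the diagonal entries split into partial fractions whose sum telescopes
  because the nodes are separated by the ratio \<open>r\<^sup>2\<close> of the two roots \<open>r t\<close> and \<open>t / r\<close>.\<close>
lemma separated_nodes_form_nonneg:
  fixes x c :: "nat \<Rightarrow> real"
  assumes r: "r > 1" and t: "t > 0"
    and pos: "\<And>i. 1 \<le> i \<Longrightarrow> i \<le> n \<Longrightarrow> x i > 0"
    and sep: "\<And>i. 1 \<le> i \<Longrightarrow> i < n \<Longrightarrow> r\<^sup>2 * x i \<le> x (i + 1)"
    and sum0: "(\<Sum>i=1..n. c i) = 0"
  shows "(\<Sum>i=1..n. (c i)\<^sup>2 * ((x i - r * t) * (x i - t / r) / x i)) \<ge> 0"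
proof (cases "\<forall>i\<in>{1..n}. (x i - r * t) * (x i - t / r) \<ge> 0")
  case True
  then show ?thesis
    using pos by (intro sum_nonneg mult_nonneg_nonneg[OF _ divide_nonneg_pos]) auto
next
  case False
  \<comment> \<open>\<open>e i\<close> is the reciprocal of the i-th diagonal entry; \<rho> and
    \<sigma> are the two roots of its numerator.\<close>
  define \<rho> \<sigma> where "\<rho> = r * t" and "\<sigma> = t / r"
  define e where "e = (\<lambda>i. x i / ((x i - \<rho>) * (x i - \<sigma>)))"
  have \<sigma>: "\<sigma> > 0" and \<rho>: "\<rho> = r\<^sup>2 * \<sigma>"
    using r t by (auto simp: \<rho>_def \<sigma>_def power2_eq_square)
  have r2: "r\<^sup>2 > 1" using r by (simp add: one_less_power)
  have "\<rho> > \<sigma>" using \<sigma> r2 by (simp add: \<rho>)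
  \<comment> \<open>A negative entry is a node strictly between \<sigma> and \<rho> = r^2 \<sigma>.
    As neighbouring nodes have ratio at least r^2, all other nodes lie outside, so their entries are
    positive.\<close>
  obtain k where k: "1 \<le> k" "k \<le> n" "\<sigma> < x k" "x k < \<rho>"
  proof -
    obtain k where "k \<in> {1..n}" "(x k - \<rho>) * (x k - \<sigma>) < 0"
      using False by (auto simp: \<rho>_def \<sigma>_def not_le)
    then show ?thesis
      using that[of k] \<open>\<rho> > \<sigma>\<close> by (auto simp: mult_less_0_iff)
  qed
  have gt_\<sigma>: "x i > \<sigma>" if "k \<le> i" "i \<le> n" for i
    using that
  proof (induction i rule: dec_induct)
    case (step i)
    have "x i \<le> r\<^sup>2 * x i" using r2 pos[of i] step k by simp
    then show ?case using step k sep[of i] by auto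
  qed (use k in auto)
  have lt_\<rho>: "x i < \<rho>" if "1 \<le> i" "i \<le> k" for i
    using that(2,1)
  proof (induction i rule: inc_induct)
    case (step i)
    have "x i \<le> r\<^sup>2 * x i" using r2 pos[of i] step k by simp
    then show ?case using step k sep[of i] by auto
  qed (use k in auto)
  have gt_\<rho>: "x i > \<rho>" if i: "k < i" "i \<le> n" for i
  proof -
    obtain i' where i': "i = i' + 1" "k \<le> i'" using i by (cases i) auto
    have "\<rho> < r\<^sup>2 * x i'"
      unfolding \<rho> using gt_\<sigma>[of i'] i i' r2 by (intro mult_strict_left_mono) auto
    then show ?thesis using sep[of i'] i i' k by auto
  qed
  have lt_\<sigma>: "x i < \<sigma>" if i: "1 \<le> i" "i < k" for i
  proof -
    have "r\<^sup>2 * x i < r\<^sup>2 * \<sigma>"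
      using sep[of i] i k lt_\<rho>[of "i + 1"] by (simp flip: \<rho>)
    then show ?thesis by (rule mult_left_less_imp_less) simp
  qed
  have e_pos: "e i > 0" if "i \<in> {1..n} - {k}" for i
  proof (cases "i < k")
    case True
    then have "(x i - \<rho>) * (x i - \<sigma>) > 0"
      using that lt_\<sigma>[of i] lt_\<rho>[of i] by (intro mult_neg_neg) auto
    then show ?thesis using that pos[of i] by (simp add: e_def)
  next
    case False
    then have "(x i - \<rho>) * (x i - \<sigma>) > 0"
      using that gt_\<rho>[of i] gt_\<sigma>[of i] by (intro mult_pos_pos) auto
    then show ?thesis using that pos[of i] by (simp add: e_def)
  qed
  have e_eq: "(\<rho> - \<sigma>) * e i = \<rho> / (x i - \<rho>) - \<sigma> / (x i - \<sigma>)" if "x i \<noteq> \<rho>" "x i \<noteq> \<sigma>" for i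
    using that by (simp add: e_def field_simps)
  \<comment> \<open>Telescoping: by \<rho> = r^2 \<sigma> and the separation, the positive partial
    fraction at \<open>Suc M\<close> is at most \<sigma> / (x M - \<sigma>), the term subtracted at
    \<open>M\<close>.\<close>
  have upper: "(\<Sum>i=k+1..M. (\<rho> - \<sigma>) * e i) \<le> \<sigma> / (x k - \<sigma>) - \<sigma> / (x M - \<sigma>)"
    if "k \<le> M" "M \<le> n" for M
    using that
  proof (induction M rule: dec_induct)
    case (step M)
    have "(\<Sum>i=k+1..Suc M. (\<rho> - \<sigma>) * e i)
        = (\<Sum>i=k+1..M. (\<rho> - \<sigma>) * e i) + (\<rho> - \<sigma>) * e (Suc M)"
      using step by simp
    also have "(\<rho> - \<sigma>) * e (Suc M) = \<rho> / (x (Suc M) - \<rho>) - \<sigma> / (x (Suc M) - \<sigma>)"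
      using gt_\<rho>[of "Suc M"] gt_\<sigma>[of "Suc M"] step by (intro e_eq) auto
    also have "\<rho> / (x (Suc M) - \<rho>) \<le> \<rho> / (r\<^sup>2 * x M - \<rho>)"
    proof -
      have "\<rho> < r\<^sup>2 * x M"
        unfolding \<rho> using gt_\<sigma>[of M] step r2 by (intro mult_strict_left_mono) auto
      then show ?thesis
        using sep[of M] step k \<sigma> \<open>\<rho> > \<sigma>\<close> by (intro divide_left_mono mult_pos_pos) auto
    qed
    also have "\<rho> / (r\<^sup>2 * x M - \<rho>) = \<sigma> / (x M - \<sigma>)"
      using r by (simp add: \<rho> flip: right_diff_distrib)
    finally show ?case using step by simp
  qed simp
  \<comment> \<open>The mirror image, descending from \<open>k\<close>: the positive fraction at
    \<open>M\<close> is at most the one subtracted at \<open>Suc M\<close>.\<close>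
  have lower: "(\<Sum>i=M..<k. (\<rho> - \<sigma>) * e i) \<le> \<rho> / (\<rho> - x k) - \<rho> / (\<rho> - x M)"
    if "M \<le> k" "1 \<le> M" for M
    using that
  proof (induction M rule: inc_induct)
    case (step M)
    have "(\<Sum>i=M..<k. (\<rho> - \<sigma>) * e i) = (\<rho> - \<sigma>) * e M + (\<Sum>i=Suc M..<k. (\<rho> - \<sigma>) * e i)"
      using step by (intro sum.atLeast_Suc_lessThan) auto
    also have "(\<rho> - \<sigma>) * e M = \<rho> / (x M - \<rho>) - \<sigma> / (x M - \<sigma>)"
      using lt_\<sigma>[of M] lt_\<rho>[of M] step by (intro e_eq) auto
    also have "\<dots> = \<sigma> / (\<sigma> - x M) - \<rho> / (\<rho> - x M)"
      using minus_divide_right[of \<rho> "\<rho> - x M"] minus_divide_right[of \<sigma> "\<sigma> - x M"] by simp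
    also have "\<sigma> / (\<sigma> - x M) = \<rho> / (\<rho> - r\<^sup>2 * x M)"
      using r by (simp add: \<rho> flip: right_diff_distrib)
    also have "\<rho> / (\<rho> - r\<^sup>2 * x M) \<le> \<rho> / (\<rho> - x (Suc M))"
      using sep[of M] step k lt_\<sigma>[of M] lt_\<rho>[of "Suc M"] r2 \<sigma>
      by (intro divide_left_mono mult_pos_pos) (auto simp: \<rho>)
    finally show ?case using step by simp
  qed simp
  have "e k < 0"
    using k pos[of k] by (auto simp: e_def divide_less_0_iff mult_less_0_iff)
  have "(\<rho> - \<sigma>) * (\<Sum>i\<in>{1..n} - {k}. e i) = (\<Sum>i=1..<k. (\<rho> - \<sigma>) * e i) + (\<Sum>i=k+1..n. (\<rho> - \<sigma>) * e i)"
  proof -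
    have "{1..n} - {k} = {1..<k} \<union> {k+1..n}" using k by auto
    then have "(\<Sum>i\<in>{1..n} - {k}. (\<rho> - \<sigma>) * e i) = (\<Sum>i\<in>{1..<k} \<union> {k+1..n}. (\<rho> - \<sigma>) * e i)"
      by (rule arg_cong)
    also have "\<dots> = (\<Sum>i=1..<k. (\<rho> - \<sigma>) * e i) + (\<Sum>i=k+1..n. (\<rho> - \<sigma>) * e i)"
      by (rule sum.union_disjoint) auto
    finally show ?thesis by (simp only: sum_distrib_left)
  qed
  also have "\<dots> \<le> (\<rho> / (\<rho> - x k) - \<rho> / (\<rho> - x 1)) + (\<sigma> / (x k - \<sigma>) - \<sigma> / (x n - \<sigma>))"
    using k by (intro add_mono lower upper) auto
  also have "\<dots> \<le> \<rho> / (\<rho> - x k) + \<sigma> / (x k - \<sigma>)"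
  proof -
    have "\<rho> / (\<rho> - x 1) \<ge> 0" "\<sigma> / (x n - \<sigma>) \<ge> 0"
      using lt_\<rho>[of 1] gt_\<sigma>[of n] k \<sigma> \<open>\<rho> > \<sigma>\<close> by auto
    then show ?thesis by linarith
  qed
  also have "\<dots> = (\<rho> - \<sigma>) * (- e k)"
    using e_eq[of k] k minus_divide_right[of \<rho> "\<rho> - x k"] by simp
  finally have e_sum: "(\<Sum>i\<in>{1..n} - {k}. e i) \<le> - e k"
    by (rule mult_left_le_imp_le) (use \<open>\<rho> > \<sigma>\<close> in simp)
  define S where "S = (\<Sum>i\<in>{1..n} - {k}. (c i)\<^sup>2 / e i)"
  have "S \<ge> 0"
    unfolding S_def using e_pos by (intro sum_nonneg divide_nonneg_pos) auto
  \<comment> \<open>The constraint expresses \<open>c k\<close> through the other coefficients, and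
    Cauchy-Schwarz with the weights \<open>e i\<close> bounds its square by S times their sum, at
    most -S \<open>e k\<close>. So the negative term is outweighed by S.\<close>
  have "c k = - (\<Sum>i\<in>{1..n} - {k}. c i)"
    using sum0 k sum.remove[of "{1..n}" k c] by simp
  then have "(c k)\<^sup>2 = (\<Sum>i\<in>{1..n} - {k}. c i)\<^sup>2"
    by simp
  also have "\<dots> \<le> S * (\<Sum>i\<in>{1..n} - {k}. e i)"
    unfolding S_def using e_pos by (rule sum_square_le_weighted)
  also have "\<dots> \<le> S * (- e k)"
    using e_sum \<open>S \<ge> 0\<close> by (rule mult_left_mono)
  finally have "(c k)\<^sup>2 / e k + S \<ge> 0"
    using \<open>e k < 0\<close> by (simp add: field_simps)
  also have "(c k)\<^sup>2 / e k + S = (\<Sum>i=1..n. (c i)\<^sup>2 / e i)"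
    using k sum.remove[of "{1..n}" k "\<lambda>i. (c i)\<^sup>2 / e i"] by (simp add: S_def)
  finally show ?thesis
    by (simp add: e_def \<rho>_def \<sigma>_def)
qed

text \<open>The quadratic x^2 - (r + 1/r) t x + t^2 has the roots r t and t / r, so quadrature makes
  this combination a diagonal form with factored entries.\<close>

lemma Q_form_eq:
  assumes a: "degree a + 2 \<le> n" and "r \<noteq> 0"
  shows "Q 2 a - (r + 1 / r) * t * Q 1 a + t\<^sup>2 * Q 0 a = (\<Sum>j=1..n.
      (poly a (laguerre_zero j n) / poly (pderiv (laguerre n)) (laguerre_zero j n))\<^sup>2 *
      ((laguerre_zero j n - r * t) * (laguerre_zero j n - t / r) / laguerre_zero j n))"
proof -
  have *: "x ^ 2 / x * c - (r + 1 / r) * t * (x ^ 1 / x * c) + t\<^sup>2 * (x ^ 0 / x * c)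
      = c * ((x - r * t) * (x - t / r) / x)" if "x > 0" for x c :: real
    using that \<open>r \<noteq> 0\<close> by (simp add: field_simps power2_eq_square)
  have Q: "Q k a = (\<Sum>j=1..n. laguerre_zero j n ^ k / laguerre_zero j n *
    (poly a (laguerre_zero j n) / poly (pderiv (laguerre n)) (laguerre_zero j n))\<^sup>2)"
    if "k \<in> {0, 1, 2}" for k
    using that by (intro Q_eq_sum_laguerre_zero a) auto
  show ?thesis
    unfolding Q[of 0, OF insertI1] Q[of 1, OF insertI2, OF insertI1]
      Q[of 2, OF insertI2, OF insertI2, OF insertI1]
    unfolding sum_distrib_left sum.distrib[symmetric] sum_subtractf[symmetric]
    by (intro sum.cong refl *) (auto intro: laguerre_zero_pos)
qed

lemma Q_pos:
  assumes "a \<noteq> 0"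
  shows "Q k a > 0"
  unfolding Q_eq_exp_moment using assms
  by (intro exp_moment_pos) (auto simp: poly_monom)

text \<open>With K = (r + 1/r) / 2, the form Q_2 - 2 K t Q_1 + t^2 Q_0 is nonnegative for t > 0. At
  its minimiser t = K Q_1 / Q_0 this says K^2 Q_1^2 <= Q_0 Q_2, and K^2 - 1 is the bound.\<close>

lemma \<V>_ge:
  assumes a: "degree a + 2 \<le> n" "a \<noteq> 0" and r: "r > 1"
    and sep: "\<And>i. 1 \<le> i \<Longrightarrow> i < n \<Longrightarrow> r\<^sup>2 * laguerre_zero i n \<le> laguerre_zero (i + 1) n"
  shows "\<V> a \<ge> (r\<^sup>2 - 1)\<^sup>2 / (4 * r\<^sup>2)"
proof -
  define K where "K = (r + 1 / r) / 2"
  have Q: "Q 0 a > 0" "Q 1 a > 0" "Q 2 a > 0"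
    using a by (auto intro: Q_pos)
  define t where "t = K * Q 1 a / Q 0 a"
  have "K > 0" using r by (simp add: K_def add_pos_pos)
  then have "t > 0" using Q by (simp add: t_def)
  have "0 \<le> Q 2 a - (r + 1 / r) * t * Q 1 a + t\<^sup>2 * Q 0 a"
    unfolding Q_form_eq[OF a(1), of r t, OF less_imp_neq[symmetric, OF less_trans[OF zero_less_one r]]]
    using r \<open>t > 0\<close> sep laguerre_zero_divided_difference_eq_0[OF a(1)]
    by (intro separated_nodes_form_nonneg) (auto intro: laguerre_zero_pos)
  also have "\<dots> = Q 2 a - K\<^sup>2 * (Q 1 a)\<^sup>2 / Q 0 a"
  proof -
    have "r + 1 / r = 2 * K" by (simp add: K_def)
    then show ?thesis
      using Q by (simp only:) (simp add: t_def field_simps power2_eq_square)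
  qed
  finally have "K\<^sup>2 \<le> Q 0 a * Q 2 a / (Q 1 a)\<^sup>2"
    using Q by (simp add: field_simps)
  moreover have "(r\<^sup>2 - 1)\<^sup>2 / (4 * r\<^sup>2) = K\<^sup>2 - 1"
    using r by (simp add: K_def field_simps power2_eq_square)
  ultimately show ?thesis
    by (simp add: \<V>_def)
qed

text \<open>Let \<open>a\<close> vanish at all zeros except two neighbours. Only two coefficients
  survive, the constraint makes them opposite, and the variance of the resulting two-point form is
  explicit.\<close>

lemma gap_ratio_attained:
  assumes "1 \<le> j" "j < n"
  shows "\<exists>a. a \<noteq> 0 \<and> degree a = n - 2 \<and> \<V> a = gap_ratio n j"
proof -
  define x where "x = (\<lambda>i. laguerre_zero i n)"
  define A where "A = {1..n} - {j, j + 1}"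
  define a where "a = (\<Prod>i\<in>A. [:- x i, 1:])"
  define c where "c = (\<lambda>i. poly a (x i) / poly (pderiv (laguerre n)) (x i))"
  have "a \<noteq> 0" by (auto simp: a_def A_def)
  have "card A = n - 2"
    using assms by (simp add: A_def card_Diff_subset)
  then have deg: "degree a = n - 2"
    unfolding a_def by (subst degree_prod_eq_sum_degree) auto
  then have deg': "degree a + 2 \<le> n"
    using assms by simp
  have x: "x j > 0" "x (j + 1) > 0" "x j < x (j + 1)"
    using assms by (auto simp: x_def intro: laguerre_zero_pos laguerre_zero_less)
  have c0: "c i = 0" if "i \<in> A" for i
    using that by (auto simp: c_def a_def poly_prod A_def)
  have split: "(\<Sum>i=1..n. f i) = f j + f (j + 1)" if "\<And>i. i \<in> A \<Longrightarrow> f i = 0" for f :: "nat \<Rightarrow> real"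
  proof -
    have "(\<Sum>i=1..n. f i) = (\<Sum>i\<in>{j, j + 1}. f i)"
      using assms that by (intro sum.mono_neutral_right) (auto simp: A_def)
    then show ?thesis by simp
  qed
  have "c j + c (j + 1) = 0"
    using laguerre_zero_divided_difference_eq_0[OF deg'] c0
    by (subst split[symmetric]) (simp_all add: c_def x_def)
  then have c: "(c (j + 1))\<^sup>2 = (c j)\<^sup>2"
    by (simp add: power2_eq_square add_eq_0_iff)
  have Q: "Q k a = (c j)\<^sup>2 * (x j ^ k / x j + x (j + 1) ^ k / x (j + 1))" if "k \<le> 2" for k
  proof -
    have "Q k a = (\<Sum>i=1..n. x i ^ k / x i * (c i)\<^sup>2)"
      unfolding Q_eq_sum_laguerre_zero[OF deg' that] c_def x_def ..
    also have "\<dots> = x j ^ k / x j * (c j)\<^sup>2 + x (j + 1) ^ k / x (j + 1) * (c (j + 1))\<^sup>2"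
      using c0 by (intro split) simp
    finally show ?thesis unfolding c by (simp add: algebra_simps)
  qed
  have "c j \<noteq> 0"
    using Q[of 0] Q_pos[of a 0] \<open>a \<noteq> 0\<close> by auto
  have "\<V> a = (1 / x j + 1 / x (j + 1)) * (x j + x (j + 1)) / 4 - 1"
  proof -
    have "Q 0 a = (c j)\<^sup>2 * (1 / x j + 1 / x (j + 1))" "Q 1 a = (c j)\<^sup>2 * 2"
      "Q 2 a = (c j)\<^sup>2 * (x j + x (j + 1))"
      using x Q[of 0] Q[of 1] Q[of 2] by (simp_all add: power2_eq_square)
    then show ?thesis
      using \<open>c j \<noteq> 0\<close> by (simp add: \<V>_def power_mult_distrib) (simp add: power2_eq_square power4_eq_xxxx)
  qed
  also have "\<dots> = gap_ratio n j"
  proof -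
    have "gap_ratio n j = (x (j + 1) - x j)\<^sup>2 / (4 * x j * x (j + 1))"
      by (simp add: gap_ratio_def x_def)
    then show ?thesis
      using x by (simp add: field_simps power2_eq_square)
  qed
  finally show ?thesis using \<open>a \<noteq> 0\<close> deg by blast
qed

text \<open>In terms of the ratio R > 1 of neighbouring zeros the gap ratio is (R - 1)^2 / (4 R),
  which increases with R. So an index with minimal gap ratio has minimal R, and the lower bound
  applies with r^2 = R.\<close>

lemma opt_variance_eq_Min: "opt_variance m = Min (gap_ratio (m + 2) ` {1..<m + 2})"
proof -
  define n where "n = m + 2"
  define G where "G = gap_ratio n ` {1..<n}"
  have G: "finite G" "G \<noteq> {}" by (auto simp: G_def n_def)
  obtain j where j: "1 \<le> j" "j < n" "gap_ratio n j = Min G"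
    using Min_in[OF G] by (auto simp: G_def)
  define R where "R = (\<lambda>i. laguerre_zero (i + 1) n / laguerre_zero i n)"
  have R_gt: "R i > 1" if "1 \<le> i" "i < n" for i
    using that laguerre_zero_pos[of i n] laguerre_zero_less[of i "i + 1" n] by (simp add: R_def)
  have gap: "gap_ratio n i = (R i - 1)\<^sup>2 / (4 * R i)" if "1 \<le> i" "i < n" for i
    using that laguerre_zero_pos[of i n] laguerre_zero_pos[of "i + 1" n]
    by (simp add: R_def gap_ratio_def field_simps power2_eq_square)
  have R_le: "R j \<le> R i" if i: "1 \<le> i" "i < n" for i
  proof (rule ccontr)
    assume "\<not> R j \<le> R i"
    then have less: "R i < R j" by simp
    have "gap_ratio n j \<le> gap_ratio n i"
      using i j G by (auto simp: G_def)
    then have "(R j - 1)\<^sup>2 * R i \<le> (R i - 1)\<^sup>2 * R j"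
      using R_gt[of i] R_gt[of j] i j by (simp add: gap field_simps)
    then have "(R j - R i) * (R i * R j - 1) \<le> 0"
      by (simp add: power2_eq_square algebra_simps)
    moreover have "R i * R j > 1"
      using R_gt[of i] R_gt[of j] i j by (intro less_1_mult) auto
    ultimately show False using less by (simp add: mult_le_0_iff)
  qed
  define r where "r = sqrt (R j)"
  have r: "r > 1" "r\<^sup>2 = R j"
    using R_gt[of j] j by (auto simp: r_def)
  have "opt_variance m = Min G"
    unfolding opt_variance_def
  proof (rule cInf_eq_minimum)
    obtain a where "a \<noteq> 0" "degree a = n - 2" "\<V> a = gap_ratio n j"
      using gap_ratio_attained[of j n] j by blast
    then show "Min G \<in> {\<V> a |a. a \<noteq> 0 \<and> degree a = m}"
      using j by (auto simp: n_def intro!: exI[of _ a])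
  next
    fix v assume "v \<in> {\<V> a |a. a \<noteq> 0 \<and> degree a = m}"
    then obtain a where a: "a \<noteq> 0" "degree a + 2 \<le> n" "v = \<V> a"
      by (auto simp: n_def)
    have "r\<^sup>2 * laguerre_zero i n \<le> laguerre_zero (i + 1) n" if "1 \<le> i" "i < n" for i
      using R_le[of i] that laguerre_zero_pos[of i n] by (simp add: r R_def field_simps)
    then have "\<V> a \<ge> (r\<^sup>2 - 1)\<^sup>2 / (4 * r\<^sup>2)"
      using a r by (intro \<V>_ge) auto
    then show "Min G \<le> v"
      using j a by (simp add: r(2) gap flip: j(3))
  qed
  then show ?thesis by (simp add: G_def n_def)
qed

section \<open>Sturm comparison\<close>

lemma zero_between_opposite_signs:
  fixes f :: "real \<Rightarrow> real"
  assumes "c < d" "continuous_on {c..d} f" "f c * f d < 0"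
  shows "\<exists>x. c < x \<and> x < d \<and> f x = 0"
proof -
  have "\<exists>x\<ge>c. x \<le> d \<and> f x = 0"
    using assms IVT'[of f c 0 d] IVT2'[of f d 0 c] by (auto simp: mult_less_0_iff)
  then show ?thesis
    using assms(3) by (auto simp: order_less_le)
qed

text \<open>Rolle-type form of Sturm's comparison with \<open>sin (\<pi> (s - a) / (b - a))\<close>, applied to the
  Wronskian of the two functions.\<close>
lemma sturm_comparison_sin:
  fixes u u' q :: "real \<Rightarrow> real"
  assumes ab: "a < b"
    and u: "\<And>s. (u has_real_derivative u' s) (at s)"
    and u': "\<And>s. (u' has_real_derivative - q s * u s) (at s)"
  shows "\<exists>\<xi> c. a < \<xi> \<and> \<xi> < b \<and> c > 0 \<and>
    c * (u a + u b) = (pi\<^sup>2 - q \<xi> * (b - a)\<^sup>2) * u \<xi>"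
proof -
  define \<kappa> where "\<kappa> = pi / (b - a)"
  define W where "W = (\<lambda>s. u' s * sin (\<kappa> * (s - a)) - u s * (\<kappa> * cos (\<kappa> * (s - a))))"
  have \<kappa>: "\<kappa> > 0" "\<kappa> * (b - a) = pi"
    using ab by (auto simp: \<kappa>_def)
  have "(W has_real_derivative (\<kappa>\<^sup>2 - q s) * u s * sin (\<kappa> * (s - a))) (at s)" for s
    unfolding W_def
    by (rule derivative_eq_intros u u' refl)+ (simp add: algebra_simps power2_eq_square)
  then obtain \<xi> where \<xi>: "a < \<xi>" "\<xi> < b"
    "W b - W a = (b - a) * ((\<kappa>\<^sup>2 - q \<xi>) * u \<xi> * sin (\<kappa> * (\<xi> - a)))"
    using MVT2[OF ab, of W "\<lambda>s. (\<kappa>\<^sup>2 - q s) * u s * sin (\<kappa> * (s - a))"] by blast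
  have "\<kappa> * (\<xi> - a) < pi"
    using \<xi> \<kappa> by (metis diff_strict_right_mono mult_strict_left_mono)
  then have sin: "sin (\<kappa> * (\<xi> - a)) > 0"
    using \<xi> \<kappa> by (intro sin_gt_zero) auto
  have "\<kappa> * (u a + u b) = (b - a) * (\<kappa>\<^sup>2 - q \<xi>) * u \<xi> * sin (\<kappa> * (\<xi> - a))"
  proof -
    \<comment> \<open>At both endpoints the sine vanishes, so \<open>u'\<close> drops out; the
      cosine is 1 at \<open>a\<close> and -1 at \<open>b\<close>.\<close>
    have "W b = \<kappa> * u b" "W a = - (\<kappa> * u a)"
      by (simp_all add: W_def \<kappa>(2))
    then show ?thesis
      using \<xi>(3) by (simp add: distrib_left mult.assoc)
  qed
  note * = this
  have "\<kappa> * (b - a) / sin (\<kappa> * (\<xi> - a)) * (u a + u b) = ((b - a) * (b - a)) * (\<kappa>\<^sup>2 - q \<xi>) * u \<xi>"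
  proof -
    have "\<kappa> * (b - a) / sin (\<kappa> * (\<xi> - a)) * (u a + u b)
        = (b - a) * (\<kappa> * (u a + u b)) / sin (\<kappa> * (\<xi> - a))"
      by simp
    also have "\<dots> = ((b - a) * (b - a)) * (\<kappa>\<^sup>2 - q \<xi>) * u \<xi>"
      unfolding * using sin by simp
    finally show ?thesis .
  qed
  also have "((b - a) * (b - a)) * (\<kappa>\<^sup>2 - q \<xi>) = pi\<^sup>2 - q \<xi> * (b - a)\<^sup>2"
    unfolding \<kappa>(2)[symmetric] by (simp add: power2_eq_square algebra_simps)
  finally show ?thesis
    using \<xi> \<kappa> sin ab by (intro exI[of _ \<xi>] exI[of _ "\<kappa> * (b - a) / sin (\<kappa> * (\<xi> - a))"]) auto
qed

text \<open>In the variable \<open>s = ln x\<close> the Laguerre equation takes the form \<open>u'' + q u = 0\<close> for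
  \<open>u = exp (- x / 2) L\<^sub>n x\<close>, with the following \<open>q\<close>.\<close>
definition laguerre_potential :: "nat \<Rightarrow> real \<Rightarrow> real" where
  "laguerre_potential n x = (real n + 1 / 2) * x - x\<^sup>2 / 4"

definition laguerre_fun :: "nat \<Rightarrow> real \<Rightarrow> real" where
  "laguerre_fun n s = exp (- exp s / 2) * poly (laguerre n) (exp s)"

definition laguerre_fun' :: "nat \<Rightarrow> real \<Rightarrow> real" where
  "laguerre_fun' n s = exp (- exp s / 2) *
    (exp s * poly (pderiv (laguerre n)) (exp s) - exp s / 2 * poly (laguerre n) (exp s))"

lemma poly_exp_deriv:
  "((\<lambda>s. poly p (exp s)) has_real_derivative poly (pderiv p) (exp s) * exp s) (at s)"
  by (rule DERIV_chain2[OF poly_DERIV DERIV_exp])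

lemma exp_half_deriv:
  "((\<lambda>s. exp (- exp s / 2)) has_real_derivative - (exp s / 2) * exp (- exp s / 2)) (at (s::real))"
  by (auto intro!: derivative_eq_intros)

lemma laguerre_fun_deriv:
  "(laguerre_fun n has_real_derivative laguerre_fun' n s) (at s)"
  unfolding laguerre_fun_def[abs_def] laguerre_fun'_def
  by (rule DERIV_cong[OF DERIV_mult[OF exp_half_deriv poly_exp_deriv]]) (simp add: field_simps)

lemma laguerre_fun'_deriv:
  "(laguerre_fun' n has_real_derivative - laguerre_potential n (exp s) * laguerre_fun n s) (at s)"
proof -
  define x l l' l'' where "x = exp s" and "l = poly (laguerre n) x"
    and "l' = poly (pderiv (laguerre n)) x" and "l'' = poly (pderiv (pderiv (laguerre n))) x"
  have ode: "x * l'' = - (1 - x) * l' - real n * l"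
    using arg_cong[OF laguerre_ode[of n], of "\<lambda>p. poly p x"]
    by (simp add: l_def l'_def l''_def algebra_simps)
  have "(laguerre_fun' n has_real_derivative
      exp (- x / 2) * (x * l' + x * (x * l'') - x / 2 * l - x / 2 * (x * l'))
      - x / 2 * exp (- x / 2) * (x * l' - x / 2 * l)) (at s)"
    unfolding laguerre_fun'_def[abs_def] l_def l'_def l''_def x_def
    by (rule DERIV_cong[OF DERIV_mult[OF exp_half_deriv DERIV_diff[OF DERIV_mult[OF DERIV_exp
        poly_exp_deriv] DERIV_mult[OF DERIV_cdivide[OF DERIV_exp] poly_exp_deriv]]]])
      (simp add: field_simps)
  also have "exp (- x / 2) * (x * l' + x * (x * l'') - x / 2 * l - x / 2 * (x * l'))
      - x / 2 * exp (- x / 2) * (x * l' - x / 2 * l) = - laguerre_potential n (exp s) * laguerre_fun n s"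
    unfolding ode
    by (simp add: laguerre_potential_def laguerre_fun_def power2_eq_square field_simps
        flip: x_def l_def)
  finally show ?thesis .
qed

lemma laguerre_fun_eq_0_iff: "laguerre_fun n s = 0 \<longleftrightarrow> poly (laguerre n) (exp s) = 0"
  by (simp add: laguerre_fun_def)

text \<open>At two neighbouring zeros the left side of the comparison identity is 0, and the
  solution has no zero between them, so the factor with \<pi>^2 must vanish.\<close>

lemma laguerre_zero_log_gap:
  assumes j: "1 \<le> j" "j < n"
  shows "\<exists>\<xi>. laguerre_zero j n < \<xi> \<and> \<xi> < laguerre_zero (j + 1) n \<and>
    (ln (laguerre_zero (j + 1) n / laguerre_zero j n))\<^sup>2 * laguerre_potential n \<xi> = pi\<^sup>2"
proof -
  define x y where "x = laguerre_zero j n" and "y = laguerre_zero (j + 1) n"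
  have xy: "0 < x" "x < y"
    using j by (auto simp: x_def y_def intro: laguerre_zero_pos laguerre_zero_less)
  then have "ln x < ln y" by simp
  then obtain s c where s: "ln x < s" "s < ln y" and c: "c * (laguerre_fun n (ln x) + laguerre_fun n (ln y)) =
      (pi\<^sup>2 - laguerre_potential n (exp s) * (ln y - ln x)\<^sup>2) * laguerre_fun n s"
    using sturm_comparison_sin[OF _ laguerre_fun_deriv laguerre_fun'_deriv, of "ln x" "ln y" n] by blast
  have es: "x < exp s" "exp s < y"
    using s xy exp_less_mono[of "ln x" s] exp_less_mono[of s "ln y"] by auto
  have "laguerre_fun n (ln x) = 0" "laguerre_fun n (ln y) = 0"
    using xy j by (simp_all add: laguerre_fun_eq_0_iff x_def y_def poly_laguerre_zero)
  moreover have "laguerre_fun n s \<noteq> 0"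
    using poly_laguerre_neq_0_between[OF j, of "exp s"] es
    by (simp add: laguerre_fun_eq_0_iff x_def y_def)
  ultimately have "laguerre_potential n (exp s) * (ln y - ln x)\<^sup>2 = pi\<^sup>2"
    using c by simp
  moreover have "ln (laguerre_zero (j + 1) n / laguerre_zero j n) = ln y - ln x"
    unfolding x_def[symmetric] y_def[symmetric] using xy by (simp add: ln_div)
  ultimately show ?thesis
    using es unfolding x_def[symmetric] y_def[symmetric]
    by (intro exI[of _ "exp s"]) (simp add: mult.commute)
qed

text \<open>If the solution had no zero inside, it would keep one sign, so the left side of the
  comparison identity could not be opposite in sign to it at the intermediate point. But the factor
  on the right is negative.\<close>

lemma laguerre_root_exists:
  assumes ab: "0 < a" "a < b"
    and q: "\<And>\<xi>. a < \<xi> \<Longrightarrow> \<xi> < b \<Longrightarrow> (ln (b / a))\<^sup>2 * laguerre_potential n \<xi> > pi\<^sup>2"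
  shows "\<exists>t. a < t \<and> t < b \<and> poly (laguerre n) t = 0"
proof (rule ccontr)
  assume no: "\<not> ?thesis"
  define u where "u = laguerre_fun n"
  have u_nz: "u s \<noteq> 0" if "ln a < s" "s < ln b" for s
  proof -
    have "a < exp s" "exp s < b"
      using that ab exp_less_mono[of "ln a" s] exp_less_mono[of s "ln b"] by auto
    then show ?thesis using no by (auto simp: u_def laguerre_fun_eq_0_iff)
  qed
  have cont: "continuous_on A u" for A
    unfolding u_def by (intro DERIV_continuous_on[OF DERIV_subset[OF laguerre_fun_deriv]]) auto
  have "ln a < ln b" using ab by simp
  then obtain s c where s: "ln a < s" "s < ln b" and c: "c > 0" "c * (u (ln a) + u (ln b)) =
      (pi\<^sup>2 - laguerre_potential n (exp s) * (ln b - ln a)\<^sup>2) * u s"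
    unfolding u_def
    using sturm_comparison_sin[OF _ laguerre_fun_deriv laguerre_fun'_deriv, of "ln a" "ln b" n] by blast
  have es: "a < exp s" "exp s < b"
    using s ab exp_less_mono[of "ln a" s] exp_less_mono[of s "ln b"] by auto
  have "u (ln a) * u s \<ge> 0"
    using zero_between_opposite_signs[OF s(1) cont] u_nz s by (force simp: not_le[symmetric])
  moreover have "u (ln b) * u s \<ge> 0"
    using zero_between_opposite_signs[OF s(2) cont] u_nz s by (force simp: not_le[symmetric] mult.commute)
  ultimately have "0 \<le> c * (u (ln a) + u (ln b)) * u s"
    using c(1) by (simp add: distrib_right mult.assoc)
  also have "\<dots> = (pi\<^sup>2 - (ln (b / a))\<^sup>2 * laguerre_potential n (exp s)) * (u s)\<^sup>2"
    using ab unfolding c(2) by (simp add: ln_div power2_eq_square mult_ac)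
  also have "\<dots> < 0"
    using q[OF es] u_nz[OF s] by (intro mult_neg_pos) auto
  finally show False by simp
qed

section \<open>Asymptotics of gaps\<close>

text \<open>In units of n + 1/2 the potential becomes (n + 1/2)^2 times the fixed function
  \<open>scaled_potential\<close>, which is positive on (0, 4) and has its maximum 1 exactly at
  2.\<close>

definition scaled_zero :: "nat \<Rightarrow> nat \<Rightarrow> real" where
  "scaled_zero n j = laguerre_zero j n / (real n + 1 / 2)"

definition log_gap :: "nat \<Rightarrow> nat \<Rightarrow> real" where
  "log_gap n j = ln (laguerre_zero (j + 1) n / laguerre_zero j n)"

definition scaled_potential :: "real \<Rightarrow> real" where
  "scaled_potential t = t - t\<^sup>2 / 4"

lemma laguerre_potential_eq:
  "laguerre_potential n x = (real n + 1 / 2)\<^sup>2 * scaled_potential (x / (real n + 1 / 2))"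
  by (simp add: laguerre_potential_def scaled_potential_def power_divide right_diff_distrib)
    (simp add: field_simps power2_eq_square)

lemma scaled_potential_eq: "scaled_potential t = 1 - (t - 2)\<^sup>2 / 4"
  by (simp add: scaled_potential_def power2_eq_square field_simps)

lemma scaled_potential_eq': "scaled_potential t = t * (4 - t) / 4"
  by (simp add: scaled_potential_def power2_eq_square field_simps)

lemma scaled_potential_le_1: "scaled_potential t \<le> 1"
  by (simp add: scaled_potential_eq)

lemma scaled_potential_pos: "0 < t \<Longrightarrow> t < 4 \<Longrightarrow> scaled_potential t > 0"
  by (simp add: scaled_potential_eq')

text \<open>Concavity: left of the peak at 2 compare with \<open>\<alpha>\<close>, right of it with
  \<open>\<beta>\<close>.\<close>

lemma scaled_potential_ge_Min:
  assumes "\<alpha> \<le> t" "t \<le> \<beta>"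
  shows "scaled_potential t \<ge> min (scaled_potential \<alpha>) (scaled_potential \<beta>)"
proof (cases "t \<le> 2")
  case True
  have "scaled_potential t - scaled_potential \<alpha> = (t - \<alpha>) * (4 - t - \<alpha>) / 4"
    by (simp add: scaled_potential_def power2_eq_square field_simps)
  also have "\<dots> \<ge> 0" using assms True by simp
  finally show ?thesis by simp
next
  case False
  have "scaled_potential t - scaled_potential \<beta> = (\<beta> - t) * (t + \<beta> - 4) / 4"
    by (simp add: scaled_potential_def power2_eq_square field_simps)
  also have "\<dots> \<ge> 0" using assms False by simp
  finally show ?thesis by simp
qed

lemma scaled_zero_less_iff:
  assumes "1 \<le> i" "i \<le> n" "1 \<le> j" "j \<le> n"
  shows "scaled_zero n i < scaled_zero n j \<longleftrightarrow> i < j"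
  using laguerre_zero_less_iff[OF assms] by (simp add: scaled_zero_def divide_less_cancel)

lemma scaled_zero_le_iff:
  assumes "1 \<le> i" "i \<le> n" "1 \<le> j" "j \<le> n"
  shows "scaled_zero n i \<le> scaled_zero n j \<longleftrightarrow> i \<le> j"
  using laguerre_zero_le_iff[OF assms] by (simp add: scaled_zero_def divide_le_cancel)

lemma log_gap_pos: "1 \<le> j \<Longrightarrow> j < n \<Longrightarrow> log_gap n j > 0"
  using laguerre_zero_less[of j "j + 1" n] laguerre_zero_pos[of j n]
  by (simp add: log_gap_def)

lemma scaled_zero_Suc:
  assumes "1 \<le> j" "j < n"
  shows "scaled_zero n (j + 1) = scaled_zero n j * exp (log_gap n j)"
  using laguerre_zero_pos[of j n] laguerre_zero_pos[of "j + 1" n] assms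
  by (simp add: scaled_zero_def log_gap_def)

text \<open>Writing y = x exp \<delta> makes (y - x)^2 / (4 x y) a function of the logarithmic gap
  \<delta> alone.\<close>

lemma gap_ratio_eq_sinh:
  assumes "1 \<le> j" "j < n"
  shows "gap_ratio n j = (sinh (log_gap n j / 2))\<^sup>2"
proof -
  define x y e where "x = laguerre_zero j n" and "y = laguerre_zero (j + 1) n"
    and "e = exp (log_gap n j / 2)"
  have x: "x > 0" "y > 0"
    using assms by (auto simp: x_def y_def laguerre_zero_pos)
  have "e > 0" by (simp add: e_def)
  have "e\<^sup>2 = exp (log_gap n j)"
    by (simp add: e_def flip: exp_double)
  then have y: "y = x * e\<^sup>2"
    using x unfolding log_gap_def x_def[symmetric] y_def[symmetric] by simp
  have "gap_ratio n j = (y - x)\<^sup>2 / (4 * x * y)"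
    by (simp add: gap_ratio_def x_def y_def)
  also have "\<dots> = ((e - inverse e) / 2)\<^sup>2"
    unfolding y using x \<open>e > 0\<close> by (simp add: field_simps power2_eq_square)
  also have "(e - inverse e) / 2 = sinh (log_gap n j / 2)"
    by (simp add: sinh_def e_def exp_minus)
  finally show ?thesis .
qed

lemma log_gap_potential:
  assumes "1 \<le> j" "j < n"
  shows "\<exists>\<tau>. scaled_zero n j < \<tau> \<and> \<tau> < scaled_zero n (j + 1) \<and>
    (log_gap n j * (real n + 1 / 2))\<^sup>2 * scaled_potential \<tau> = pi\<^sup>2"
proof -
  obtain \<xi> where \<xi>: "laguerre_zero j n < \<xi>" "\<xi> < laguerre_zero (j + 1) n"
    "(log_gap n j)\<^sup>2 * laguerre_potential n \<xi> = pi\<^sup>2"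
    using laguerre_zero_log_gap[OF assms] by (auto simp: log_gap_def)
  then show ?thesis
    by (intro exI[of _ "\<xi> / (real n + 1 / 2)"])
      (simp add: scaled_zero_def divide_strict_right_mono laguerre_potential_eq power_mult_distrib
        mult.assoc)
qed

text \<open>The scaled potential is at most 1, which keeps every gap from being shorter, uniformly
  in the index.\<close>

lemma log_gap_ge:
  assumes "1 \<le> j" "j < n"
  shows "pi \<le> log_gap n j * (real n + 1 / 2)"
proof -
  obtain \<tau> where "(log_gap n j * (real n + 1 / 2))\<^sup>2 * scaled_potential \<tau> = pi\<^sup>2"
    using log_gap_potential[OF assms] by blast
  then have "pi\<^sup>2 \<le> (log_gap n j * (real n + 1 / 2))\<^sup>2"
    using mult_left_mono[OF scaled_potential_le_1[of \<tau>], of "(log_gap n j * (real n + 1 / 2))\<^sup>2"]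
    by simp
  then show ?thesis
    by (rule power2_le_imp_le) (use log_gap_pos[OF assms] in simp)
qed

lemma gap_ratio_ge:
  assumes "1 \<le> j" "j < n"
  shows "(log_gap n j * (real n + 1 / 2) / 2)\<^sup>2 \<le> gap_ratio n j * (real n + 1 / 2)\<^sup>2"
proof -
  have "log_gap n j / 2 \<le> sinh (log_gap n j / 2)"
    using log_gap_pos[OF assms] real_le_x_sinh[of "log_gap n j / 2"]
    by (simp add: sinh_field_def exp_minus)
  then have "(log_gap n j / 2)\<^sup>2 \<le> gap_ratio n j"
    unfolding gap_ratio_eq_sinh[OF assms] using log_gap_pos[OF assms] by (intro power_mono) auto
  then show ?thesis
    using mult_right_mono[of "(log_gap n j / 2)\<^sup>2" "gap_ratio n j" "(real n + 1 / 2)\<^sup>2"]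
    by (simp add: power_mult_distrib power_divide)
qed

text \<open>The scaled potential is bounded below by a positive constant on the window, so the
  existence criterion holds as soon as (n + 1/2)^2 is large.\<close>

lemma eventually_scaled_zero_between:
  assumes "0 < \<alpha>" "\<alpha> < \<beta>" "\<beta> < 4"
  shows "\<forall>\<^sub>F n in sequentially. \<exists>j. 1 \<le> j \<and> j \<le> n \<and> \<alpha> < scaled_zero n j \<and> scaled_zero n j < \<beta>"
proof -
  define c where "c = min (scaled_potential \<alpha>) (scaled_potential \<beta>)"
  define d where "d = (ln (\<beta> / \<alpha>))\<^sup>2 * c"
  have "c > 0" using assms by (simp add: c_def scaled_potential_pos)
  moreover have "ln (\<beta> / \<alpha>) > 0" using assms by simp
  ultimately have "d > 0" by (simp add: d_def)
  then have "filterlim (\<lambda>n. (real n + 1 / 2)\<^sup>2 * d) at_top sequentially"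
    by real_asymp
  then have "\<forall>\<^sub>F n in sequentially. (real n + 1 / 2)\<^sup>2 * d > pi\<^sup>2"
    by (simp add: filterlim_at_top_dense)
  then show ?thesis
  proof eventually_elim
    case (elim n)
    define \<nu> where "\<nu> = real n + 1 / 2"
    have \<nu>: "\<nu> > 0" by (simp add: \<nu>_def)
    have "\<exists>t. \<alpha> * \<nu> < t \<and> t < \<beta> * \<nu> \<and> poly (laguerre n) t = 0"
    proof (rule laguerre_root_exists)
      fix \<xi> assume \<xi>: "\<alpha> * \<nu> < \<xi>" "\<xi> < \<beta> * \<nu>"
      then have "c \<le> scaled_potential (\<xi> / \<nu>)"
        unfolding c_def using \<nu> by (intro scaled_potential_ge_Min) (simp_all add: field_simps)
      then have "(ln (\<beta> / \<alpha>))\<^sup>2 * (\<nu>\<^sup>2 * c) \<le> (ln (\<beta> / \<alpha>))\<^sup>2 * (\<nu>\<^sup>2 * scaled_potential (\<xi> / \<nu>))"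
        by (intro mult_left_mono) auto
      moreover have "pi\<^sup>2 < (ln (\<beta> / \<alpha>))\<^sup>2 * (\<nu>\<^sup>2 * c)"
        using elim by (simp add: d_def mult_ac flip: \<nu>_def)
      ultimately have "pi\<^sup>2 < (ln (\<beta> / \<alpha>))\<^sup>2 * (\<nu>\<^sup>2 * scaled_potential (\<xi> / \<nu>))"
        by (rule order.strict_trans2[rotated])
      then show "(ln (\<beta> * \<nu> / (\<alpha> * \<nu>)))\<^sup>2 * laguerre_potential n \<xi> > pi\<^sup>2"
        using \<nu> by (simp add: laguerre_potential_eq flip: \<nu>_def)
    qed (use assms \<nu> in auto)
    then obtain t where t: "\<alpha> * \<nu> < t" "t < \<beta> * \<nu>" "poly (laguerre n) t = 0" by blast
    obtain j where "1 \<le> j" "j \<le> n" "t = laguerre_zero j n"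
      using t(3) by (rule laguerre_root_obtain_index)
    then show ?case
      using t \<nu> by (intro exI[of _ j]) (simp add: scaled_zero_def field_simps flip: \<nu>_def)
  qed
qed

section \<open>Counting zeros\<close>

text \<open>The integral of \<open>sqrt (scaled_potential t) / t\<close> from 0, by the substitution
  \<open>t = 4 (sin \<theta>)\<^sup>2\<close>; \<open>arc_count t / \<pi>\<close> is the limiting proportion of scaled zeros below \<open>t\<close>.\<close>
definition arc_count :: "real \<Rightarrow> real" where
  "arc_count t = 2 * arcsin (sqrt t / 2) + sqrt (scaled_potential t)"

lemma arc_count_values: "arc_count 0 = 0" "arc_count 2 = pi / 2 + 1" "arc_count 4 = pi"
proof -
  have "arcsin (sqrt 2 / 2) = pi / 4"
    using arcsin_sin[of "pi / 4"] by (simp add: sin_45)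
  then show "arc_count 2 = pi / 2 + 1"
    by (simp add: arc_count_def scaled_potential_def)
qed (simp_all add: arc_count_def scaled_potential_def)

lemma continuous_on_arc_count: "continuous_on {0..4} arc_count"
proof -
  have *: "\<forall>t\<in>{0..4}. - 1 \<le> sqrt t / 2 \<and> sqrt t / 2 \<le> 1"
  proof (intro ballI conjI)
    fix t :: real assume t: "t \<in> {0..4}"
    show "- 1 \<le> sqrt t / 2"
      by (rule order.trans[of _ 0]) (use t in auto)
    show "sqrt t / 2 \<le> 1"
      using t real_sqrt_le_mono[of t 4] by simp
  qed
  show ?thesis
    unfolding arc_count_def[abs_def] scaled_potential_def
    by (intro continuous_intros *) auto
qed

lemma arc_count_near_0:
  assumes "e > 0"
  shows "\<exists>d>0. \<forall>t. 0 \<le> t \<longrightarrow> t \<le> 4 \<longrightarrow> t < d \<longrightarrow> arc_count t < e"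
proof -
  obtain d where d: "d > 0"
    "\<And>t. t \<in> {0..4} \<Longrightarrow> dist t 0 < d \<Longrightarrow> dist (arc_count t) (arc_count 0) < e"
    using continuous_on_arc_count[unfolded continuous_on_iff, rule_format, of 0 e] assms by auto
  have "arc_count t < e" if "0 \<le> t" "t \<le> 4" "t < d" for t
    using d(2)[of t] that by (simp add: dist_real_def arc_count_values)
  then show ?thesis using d(1) by blast
qed

lemma arc_count_near_4:
  assumes "e > 0"
  shows "\<exists>d>0. \<forall>t. 0 \<le> t \<longrightarrow> t \<le> 4 \<longrightarrow> 4 - d < t \<longrightarrow> pi - e < arc_count t"
proof -
  obtain d where d: "d > 0"
    "\<And>t. t \<in> {0..4} \<Longrightarrow> dist t 4 < d \<Longrightarrow> dist (arc_count t) (arc_count 4) < e"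
    using continuous_on_arc_count[unfolded continuous_on_iff, rule_format, of 4 e] assms by auto
  have "pi - e < arc_count t" if "0 \<le> t" "t \<le> 4" "4 - d < t" for t
    using d(2)[of t] that by (simp add: dist_real_def arc_count_values abs_less_iff)
  then show ?thesis using d(1) by blast
qed

lemma arc_count_deriv:
  assumes "0 < t" "t < 4"
  shows "(arc_count has_real_derivative sqrt (scaled_potential t) / t) (at t)"
proof -
  \<comment> \<open>With sin \<theta> = sqrt t / 2 these are r = 2 sin \<theta> and v = cos
    \<theta>, and the root of the potential is r v.\<close>
  define r v where "r = sqrt t" and "v = sqrt (1 - (sqrt t / 2)\<^sup>2)"
  have r: "r > 0" "t = r\<^sup>2" and "sqrt t / 2 < 1"
    using assms real_sqrt_less_mono[of t 4] by (auto simp: r_def)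
  have v: "v > 0" "v\<^sup>2 = 1 - t / 4"
    using assms by (auto simp: v_def power_divide)
  have w: "sqrt (scaled_potential t) = r * v"
  proof (rule real_sqrt_unique)
    have "(r * v)\<^sup>2 = t * (1 - t / 4)"
      unfolding power_mult_distrib v(2) r(2)[symmetric] ..
    then show "(r * v)\<^sup>2 = scaled_potential t"
      by (simp add: scaled_potential_def power2_eq_square right_diff_distrib)
  qed (use r v in simp)
  have "((\<lambda>t. arcsin (sqrt t / 2)) has_real_derivative inverse v * (inverse r / 2 / 2)) (at t)"
    unfolding v_def r_def using assms \<open>sqrt t / 2 < 1\<close>
    by (intro DERIV_chain2[OF DERIV_arcsin] DERIV_cdivide DERIV_real_sqrt)
      (auto intro: less_le_trans[of _ 0])
  moreover have "(scaled_potential has_real_derivative 1 - t / 2) (at t)"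
    unfolding scaled_potential_def[abs_def] by (auto intro!: derivative_eq_intros)
  then have "((\<lambda>t. sqrt (scaled_potential t)) has_real_derivative
      inverse (r * v) / 2 * (1 - t / 2)) (at t)"
    unfolding w[symmetric] using assms
    by (intro DERIV_chain2[OF DERIV_real_sqrt]) (auto simp: scaled_potential_pos)
  ultimately have "(arc_count has_real_derivative
      2 * (inverse v * (inverse r / 2 / 2)) + inverse (r * v) / 2 * (1 - t / 2)) (at t)"
    unfolding arc_count_def[abs_def] by (intro DERIV_add DERIV_cmult)
  also have "2 * (inverse v * (inverse r / 2 / 2)) + inverse (r * v) / 2 * (1 - t / 2)
      = (1 - t / 4) / (r * v)"
    using r(1) v(1) by (simp add: field_simps)
  also have "\<dots> = r * v / t"
    using r v(1) unfolding v(2)[symmetric] by (simp add: power2_eq_square)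
  finally show ?thesis unfolding w .
qed

text \<open>Bounds n + 1/2 times the growth of \<open>arc_count\<close> over one gap inside
  [\<alpha>, 4 - \<alpha>]. There \<open>d\<close> bounds the logarithmic gap, and the two factors
  under the root bound how much t and 4 - t can vary within a gap.\<close>

definition step_bound :: "real \<Rightarrow> nat \<Rightarrow> real" where
  "step_bound \<alpha> n = (let d = pi / ((real n + 1 / 2) * sqrt (scaled_potential \<alpha>))
    in pi * sqrt (exp d * (1 + 4 * (exp d - 1) / \<alpha>)))"

lemma step_bound_tendsto:
  assumes "0 < \<alpha>" "\<alpha> < 4"
  shows "step_bound \<alpha> \<longlonglongrightarrow> pi"
proof -
  have "sqrt (scaled_potential \<alpha>) > 0"
    using assms by (simp add: scaled_potential_pos)
  then have "(\<lambda>n. pi / ((real n + 1 / 2) * sqrt (scaled_potential \<alpha>))) \<longlonglongrightarrow> 0"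
    by real_asymp
  then have "step_bound \<alpha> \<longlonglongrightarrow> pi * sqrt (exp 0 * (1 + 4 * (exp 0 - 1) / \<alpha>))"
    unfolding step_bound_def[abs_def] Let_def using assms by (intro tendsto_intros) auto
  then show ?thesis by simp
qed

text \<open>On each gap \<open>arc_count\<close> grows by \<open>log_gap\<close> times an intermediate value of the root of the
  potential, and the product of \<open>log_gap\<close> with another intermediate value is \<open>\<pi>\<close>.\<close>
lemma arc_count_step:
  assumes j: "1 \<le> j" "j < n" and \<alpha>: "0 < \<alpha>" "\<alpha> \<le> scaled_zero n j" "scaled_zero n (j + 1) \<le> 4 - \<alpha>"
  shows "(real n + 1 / 2) * (arc_count (scaled_zero n (j + 1)) - arc_count (scaled_zero n j))
    \<le> step_bound \<alpha> n"
proof -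
  define \<nu> where "\<nu> = real n + 1 / 2"
  define t t' \<delta> where "t = scaled_zero n j" and "t' = scaled_zero n (j + 1)" and "\<delta> = log_gap n j"
  have \<nu>: "\<nu> > 0" by (simp add: \<nu>_def)
  have \<delta>: "\<delta> > 0" "t' = t * exp \<delta>"
    using log_gap_pos[OF j] scaled_zero_Suc[OF j] by (simp_all add: t_def t'_def \<delta>_def)
  have t: "0 < t" "t < t'" "\<alpha> \<le> t" "t' \<le> 4 - \<alpha>"
    using \<alpha> \<delta> by (auto simp: t_def t'_def)
  have "\<alpha> < 4" "t \<le> 4" using t \<alpha> by linarith+
  obtain \<tau> where \<tau>: "t < \<tau>" "\<tau> < t'" "(\<delta> * \<nu>)\<^sup>2 * scaled_potential \<tau> = pi\<^sup>2"
    using log_gap_potential[OF j] by (auto simp: t_def t'_def \<delta>_def \<nu>_def)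
  have "sqrt ((\<delta> * \<nu>)\<^sup>2 * scaled_potential \<tau>) = sqrt (pi\<^sup>2)"
    by (simp only: \<tau>(3))
  then have \<tau>_eq: "\<delta> * \<nu> * sqrt (scaled_potential \<tau>) = pi"
    using \<delta> \<nu> by (simp add: real_sqrt_mult)
  have "ln t < ln t'" using t by simp
  moreover have "((\<lambda>s. arc_count (exp s)) has_real_derivative sqrt (scaled_potential (exp s))) (at s)"
    if "ln t \<le> s" "s \<le> ln t'" for s
  proof -
    have "exp s \<le> t'" using that t by (simp add: ln_ge_iff)
    then have "exp s < 4" using t \<alpha> by linarith
    then have "((\<lambda>s. arc_count (exp s)) has_real_derivative
        sqrt (scaled_potential (exp s)) / exp s * exp s) (at s)"
      by (intro DERIV_chain2[OF arc_count_deriv] DERIV_exp) auto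
    then show ?thesis by simp
  qed
  ultimately obtain s where s: "ln t < s" "s < ln t'"
    "arc_count (exp (ln t')) - arc_count (exp (ln t)) = (ln t' - ln t) * sqrt (scaled_potential (exp s))"
    using MVT2[of "ln t" "ln t'" "\<lambda>s. arc_count (exp s)" "\<lambda>s. sqrt (scaled_potential (exp s))"] by blast
  define \<eta> where "\<eta> = exp s"
  have \<eta>: "t < \<eta>" "\<eta> < t'"
    using s(1,2) t exp_less_mono[of "ln t" s] exp_less_mono[of s "ln t'"] by (auto simp: \<eta>_def)
  have "ln t' - ln t = \<delta>"
    using t \<delta> by (simp add: ln_mult)
  then have diff: "arc_count t' - arc_count t = \<delta> * sqrt (scaled_potential \<eta>)"
    using s(3) t by (simp add: \<eta>_def)
  \<comment> \<open>On [\<alpha>, 4 - \<alpha>] the potential is at least its value at the ends, so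
    the identity at \<tau> bounds \<delta> by \<open>d\<close>.\<close>
  define d where "d = pi / (\<nu> * sqrt (scaled_potential \<alpha>))"
  have sp_\<alpha>: "sqrt (scaled_potential \<alpha>) > 0"
    using \<alpha> \<open>\<alpha> < 4\<close> by (simp add: scaled_potential_pos)
  have "scaled_potential (4 - \<alpha>) = scaled_potential \<alpha>"
    by (simp add: scaled_potential_eq')
  then have "scaled_potential \<alpha> \<le> scaled_potential \<tau>"
    using scaled_potential_ge_Min[of \<alpha> \<tau> "4 - \<alpha>"] t \<tau> by simp
  then have "\<delta> * \<nu> * sqrt (scaled_potential \<alpha>) \<le> pi"
    unfolding \<tau>_eq[symmetric] using \<delta> \<nu> by (intro mult_left_mono) auto
  then have "\<delta> \<le> d"
    using \<nu> sp_\<alpha> by (simp add: d_def field_simps)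
  define K where "K = exp d * (1 + 4 * (exp d - 1) / \<alpha>)"
  have "\<eta> \<le> exp d * \<tau>"
  proof -
    have "\<eta> \<le> t * exp \<delta>" using \<eta> \<delta> by simp
    also have "\<dots> \<le> \<tau> * exp d" using \<open>\<delta> \<le> d\<close> \<tau> t by (intro mult_mono) auto
    finally show ?thesis by (simp add: mult.commute)
  qed
  \<comment> \<open>The additive error 4 (exp d - 1) becomes a relative one because 4 - \<tau> is at
    least \<alpha>.\<close>
  moreover have "4 - \<eta> \<le> (1 + 4 * (exp d - 1) / \<alpha>) * (4 - \<tau>)"
  proof -
    have "\<tau> - \<eta> \<le> t * (exp \<delta> - 1)"
      using \<eta> \<tau> \<delta> by (simp add: algebra_simps)
    also have "\<dots> \<le> 4 * (exp d - 1)"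
      using \<open>\<delta> \<le> d\<close> \<delta> \<open>t \<le> 4\<close> by (intro mult_mono) auto
    also have "\<dots> = 4 * (exp d - 1) / \<alpha> * \<alpha>"
      using \<alpha> by simp
    also have "\<dots> \<le> 4 * (exp d - 1) / \<alpha> * (4 - \<tau>)"
      using \<open>\<delta> \<le> d\<close> \<delta> t \<tau> \<alpha> by (intro mult_left_mono) auto
    finally show ?thesis by (simp add: algebra_simps)
  qed
  ultimately have *: "\<eta> * (4 - \<eta>) \<le> exp d * \<tau> * ((1 + 4 * (exp d - 1) / \<alpha>) * (4 - \<tau>))"
    using t \<tau> \<eta> \<alpha> by (intro mult_mono) auto
  have "scaled_potential \<eta> \<le> K * scaled_potential \<tau>"
  proof -
    have "K * scaled_potential \<tau> = exp d * \<tau> * ((1 + 4 * (exp d - 1) / \<alpha>) * (4 - \<tau>)) / 4"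
      by (simp only: scaled_potential_eq' K_def times_divide_eq_right mult_ac)
    then show ?thesis
      using divide_right_mono[OF *, of 4] unfolding scaled_potential_eq'[of \<eta>] by linarith
  qed
  then have "sqrt (scaled_potential \<eta>) \<le> sqrt K * sqrt (scaled_potential \<tau>)"
    using real_sqrt_le_mono by (fastforce simp flip: real_sqrt_mult)
  then have "\<delta> * \<nu> * sqrt (scaled_potential \<eta>) \<le> \<delta> * \<nu> * (sqrt K * sqrt (scaled_potential \<tau>))"
    using \<delta> \<nu> by (intro mult_left_mono) auto
  also have "\<dots> = \<delta> * \<nu> * sqrt (scaled_potential \<tau>) * sqrt K"
    by simp
  also have "\<dots> = step_bound \<alpha> n"
    unfolding \<tau>_eq by (simp add: step_bound_def K_def d_def \<nu>_def Let_def)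
  finally show ?thesis
    using diff by (simp add: t_def t'_def \<nu>_def mult_ac)
qed

lemma arc_count_diff_le:
  assumes "a \<le> b" "1 \<le> a" "b \<le> n" and "0 < \<alpha>" "\<alpha> \<le> scaled_zero n a" "scaled_zero n b \<le> 4 - \<alpha>"
  shows "(real n + 1 / 2) * (arc_count (scaled_zero n b) - arc_count (scaled_zero n a))
    \<le> real (b - a) * step_bound \<alpha> n"
  using assms(1,3,6)
proof (induction b rule: dec_induct)
  case (step c)
  have "scaled_zero n a \<le> scaled_zero n c" "scaled_zero n c < scaled_zero n (c + 1)"
    using assms(2) step by (simp_all add: scaled_zero_le_iff scaled_zero_less_iff)
  then have "(real n + 1 / 2) * (arc_count (scaled_zero n c) - arc_count (scaled_zero n a))
      \<le> real (c - a) * step_bound \<alpha> n"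
    and "(real n + 1 / 2) * (arc_count (scaled_zero n (c + 1)) - arc_count (scaled_zero n c))
      \<le> step_bound \<alpha> n"
    using assms(2,4,5) step by (auto intro!: step.IH arc_count_step[of c, simplified])
  moreover have "real (Suc c - a) = real (c - a) + 1"
    using step by (simp add: Suc_diff_le)
  ultimately show ?case by (simp add: algebra_simps)
qed simp

lemma nat_over_scale_tendsto: "(\<lambda>n. real n / (real n + 1 / 2)) \<longlonglongrightarrow> 1"
  by real_asymp

text \<open>Both bounds are lower bounds for numbers of zeros: of those below \<open>J n\<close> and of those
  above it.\<close>
lemma zero_index_tendsto:
  assumes J: "\<forall>\<^sub>F n in sequentially. 1 \<le> J n \<and> J n \<le> n"
    and lim: "(\<lambda>n. scaled_zero n (J n)) \<longlonglongrightarrow> 2"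
  shows "(\<lambda>n. real (J n) / (real n + 1 / 2)) \<longlonglongrightarrow> arc_count 2 / pi"
proof (rule order_tendstoI)
  have cont: "isCont arc_count 2"
    using arc_count_deriv[of 2] by (auto intro: DERIV_isCont)
  have G_lim: "(\<lambda>n. arc_count (scaled_zero n (J n))) \<longlonglongrightarrow> arc_count 2"
    by (rule isCont_tendsto_compose[OF cont lim])
  {
    fix l assume l: "l < arc_count 2 / pi"
    define \<eta> where "\<eta> = arc_count 2 - l * pi"
    have "\<eta> > 0" using l by (simp add: \<eta>_def field_simps)
    obtain d where d: "d > 0" "\<And>t. 0 \<le> t \<Longrightarrow> t \<le> 4 \<Longrightarrow> t < d \<Longrightarrow> arc_count t < \<eta> / 2"
      using arc_count_near_0[of "\<eta> / 2"] \<open>\<eta> > 0\<close> by auto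
    \<comment> \<open>The cap 1/2 puts the window (\<alpha>, 2 \<alpha>) below 1, hence left of the
      zero with index \<open>J n\<close>; 2 \<alpha> <= d makes \<open>arc_count\<close> smaller
      than \<eta> / 2 there.\<close>
    define \<alpha> where "\<alpha> = min (1 / 2) (d / 2)"
    have \<alpha>: "0 < \<alpha>" "\<alpha> \<le> 1 / 2" "2 * \<alpha> \<le> d" using d by (auto simp: \<alpha>_def)
    have "(\<lambda>n. (arc_count (scaled_zero n (J n)) - \<eta> / 2) / step_bound \<alpha> n)
        \<longlonglongrightarrow> (arc_count 2 - \<eta> / 2) / pi"
      using \<alpha> by (intro tendsto_intros G_lim step_bound_tendsto) auto
    moreover have "l < (arc_count 2 - \<eta> / 2) / pi"
      using \<open>\<eta> > 0\<close> by (simp add: \<eta>_def field_simps)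
    ultimately have "\<forall>\<^sub>F n in sequentially. l < (arc_count (scaled_zero n (J n)) - \<eta> / 2) / step_bound \<alpha> n"
      by (rule order_tendstoD(1))
    moreover have "\<forall>\<^sub>F n in sequentially. step_bound \<alpha> n > 0"
      using \<alpha> by (intro order_tendstoD(1)[OF step_bound_tendsto]) auto
    moreover have "\<forall>\<^sub>F n in sequentially. \<exists>a. 1 \<le> a \<and> a \<le> n \<and> \<alpha> < scaled_zero n a \<and> scaled_zero n a < 2 * \<alpha>"
      using \<alpha> by (intro eventually_scaled_zero_between) auto
    moreover have "\<forall>\<^sub>F n in sequentially. scaled_zero n (J n) > 1"
      "\<forall>\<^sub>F n in sequentially. scaled_zero n (J n) < 3"
      using order_tendstoD[OF lim] by auto
    ultimately show "\<forall>\<^sub>F n in sequentially. l < real (J n) / (real n + 1 / 2)"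
      using J
    proof eventually_elim
      case (elim n)
      define \<nu> where "\<nu> = real n + 1 / 2"
      have \<nu>: "\<nu> > 0" by (simp add: \<nu>_def)
      obtain a where a: "1 \<le> a" "a \<le> n" "\<alpha> < scaled_zero n a" "scaled_zero n a < 2 * \<alpha>"
        using elim by blast
      have "scaled_zero n a < scaled_zero n (J n)"
        using a elim \<alpha> by linarith
      then have "a \<le> J n"
        using a elim by (simp add: scaled_zero_less_iff)
      then have "\<nu> * (arc_count (scaled_zero n (J n)) - arc_count (scaled_zero n a))
          \<le> real (J n - a) * step_bound \<alpha> n"
        unfolding \<nu>_def using a elim \<alpha> by (intro arc_count_diff_le) auto
      also have "\<dots> \<le> real (J n) * step_bound \<alpha> n"
        using elim by (intro mult_right_mono) auto
      finally have "arc_count (scaled_zero n (J n)) - arc_count (scaled_zero n a)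
          \<le> real (J n) / \<nu> * step_bound \<alpha> n"
        using \<nu> by (simp add: field_simps)
      moreover have "arc_count (scaled_zero n a) < \<eta> / 2"
        using a \<alpha> by (intro d(2)) auto
      ultimately have "arc_count (scaled_zero n (J n)) - \<eta> / 2 \<le> real (J n) / \<nu> * step_bound \<alpha> n"
        by simp
      then have "(arc_count (scaled_zero n (J n)) - \<eta> / 2) / step_bound \<alpha> n \<le> real (J n) / \<nu>"
        using elim by (simp add: divide_le_eq)
      then show ?case
        using elim by (simp add: \<nu>_def)
    qed
  next
    fix u assume u: "arc_count 2 / pi < u"
    define \<eta> where "\<eta> = u * pi - arc_count 2"
    have "\<eta> > 0" using u by (simp add: \<eta>_def field_simps)
    obtain d where d: "d > 0" "\<And>t. 0 \<le> t \<Longrightarrow> t \<le> 4 \<Longrightarrow> 4 - d < t \<Longrightarrow> arc_count t > pi - \<eta> / 2"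
      using arc_count_near_4[of "\<eta> / 2"] \<open>\<eta> > 0\<close> by auto
    \<comment> \<open>Mirrored choice: the window (4 - 2 \<alpha>, 4 - \<alpha>) lies above 3, right
      of the zero with index \<open>J n\<close>, and \<open>arc_count\<close> exceeds \<pi> - \<eta>
      / 2 there. A lower bound for n - \<open>J n\<close> then bounds \<open>J n\<close> from
      above.\<close>
    define \<alpha> where "\<alpha> = min (1 / 2) (d / 2)"
    have \<alpha>: "0 < \<alpha>" "\<alpha> \<le> 1 / 2" "2 * \<alpha> \<le> d" using d by (auto simp: \<alpha>_def)
    have "(\<lambda>n. real n / (real n + 1 / 2) - (pi - \<eta> / 2 - arc_count (scaled_zero n (J n))) / step_bound \<alpha> n)
        \<longlonglongrightarrow> 1 - (pi - \<eta> / 2 - arc_count 2) / pi"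
      using \<alpha> by (intro tendsto_intros G_lim step_bound_tendsto nat_over_scale_tendsto) auto
    moreover have "1 - (pi - \<eta> / 2 - arc_count 2) / pi < u"
      using \<open>\<eta> > 0\<close> by (simp add: \<eta>_def field_simps)
    ultimately have "\<forall>\<^sub>F n in sequentially. real n / (real n + 1 / 2) -
        (pi - \<eta> / 2 - arc_count (scaled_zero n (J n))) / step_bound \<alpha> n < u"
      by (rule order_tendstoD(2))
    moreover have "\<forall>\<^sub>F n in sequentially. step_bound \<alpha> n > 0"
      using \<alpha> by (intro order_tendstoD(1)[OF step_bound_tendsto]) auto
    moreover have "\<forall>\<^sub>F n in sequentially. \<exists>b. 1 \<le> b \<and> b \<le> n \<and>
        4 - 2 * \<alpha> < scaled_zero n b \<and> scaled_zero n b < 4 - \<alpha>"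
      using \<alpha> by (intro eventually_scaled_zero_between) auto
    moreover have "\<forall>\<^sub>F n in sequentially. scaled_zero n (J n) > 1"
      "\<forall>\<^sub>F n in sequentially. scaled_zero n (J n) < 3"
      using order_tendstoD[OF lim] by auto
    ultimately show "\<forall>\<^sub>F n in sequentially. real (J n) / (real n + 1 / 2) < u"
      using J
    proof eventually_elim
      case (elim n)
      define \<nu> where "\<nu> = real n + 1 / 2"
      have \<nu>: "\<nu> > 0" by (simp add: \<nu>_def)
      obtain b where b: "1 \<le> b" "b \<le> n" "4 - 2 * \<alpha> < scaled_zero n b" "scaled_zero n b < 4 - \<alpha>"
        using elim by blast
      have "scaled_zero n (J n) < scaled_zero n b"
        using b elim \<alpha> by linarith
      then have "J n \<le> b"
        using b elim by (simp add: scaled_zero_less_iff)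
      then have "\<nu> * (arc_count (scaled_zero n b) - arc_count (scaled_zero n (J n)))
          \<le> real (b - J n) * step_bound \<alpha> n"
        unfolding \<nu>_def using b elim \<alpha> by (intro arc_count_diff_le) auto
      also have "\<dots> \<le> (real n - real (J n)) * step_bound \<alpha> n"
        using elim b \<open>J n \<le> b\<close> by (intro mult_right_mono) auto
      finally have "arc_count (scaled_zero n b) - arc_count (scaled_zero n (J n))
          \<le> (real n / \<nu> - real (J n) / \<nu>) * step_bound \<alpha> n"
        using \<nu> by (simp add: field_simps)
      moreover have "arc_count (scaled_zero n b) > pi - \<eta> / 2"
        using b \<alpha> by (intro d(2)) auto
      ultimately have "pi - \<eta> / 2 - arc_count (scaled_zero n (J n))
          \<le> (real n / \<nu> - real (J n) / \<nu>) * step_bound \<alpha> n"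
        by simp
      then have "(pi - \<eta> / 2 - arc_count (scaled_zero n (J n))) / step_bound \<alpha> n
          \<le> real n / \<nu> - real (J n) / \<nu>"
        using elim by (simp add: divide_le_eq)
      then show ?case
        using elim by (simp add: \<nu>_def)
    qed
  }
qed

section \<open>Consequences of a logarithmic gap asymptotic to \<pi> / (n + 1/2)\<close>

lemma log_gap_tendsto_0:
  assumes "(\<lambda>n. log_gap n (J n) * (real n + 1 / 2)) \<longlonglongrightarrow> L"
  shows "(\<lambda>n. log_gap n (J n)) \<longlonglongrightarrow> 0"
proof -
  have "(\<lambda>n. 1 / (real n + 1 / 2)) \<longlonglongrightarrow> 0" by real_asymp
  from tendsto_mult[OF assms this] show ?thesis by simp
qed

text \<open>The gap identity forces the potential at the intermediate point \<tau> to tend to its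
  maximum 1, attained only at 2, so \<tau> tends to 2. The two zeros enclose \<tau> and their ratio
  tends to 1.\<close>

lemma scaled_zero_tendsto_2:
  assumes J: "\<forall>\<^sub>F n in sequentially. 1 \<le> J n \<and> J n < n"
    and lim: "(\<lambda>n. log_gap n (J n) * (real n + 1 / 2)) \<longlonglongrightarrow> pi"
  shows "(\<lambda>n. scaled_zero n (J n)) \<longlonglongrightarrow> 2" "(\<lambda>n. scaled_zero n (J n + 1)) \<longlonglongrightarrow> 2"
proof -
  define P where "P = (\<lambda>n \<tau>. scaled_zero n (J n) < \<tau> \<and> \<tau> < scaled_zero n (J n + 1) \<and>
    (log_gap n (J n) * (real n + 1 / 2))\<^sup>2 * scaled_potential \<tau> = pi\<^sup>2)"
  define \<tau> where "\<tau> = (\<lambda>n. SOME \<tau>. P n \<tau>)"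
  have P: "\<forall>\<^sub>F n in sequentially. P n (\<tau> n)"
    using J
  proof eventually_elim
    case (elim n)
    then have "\<exists>\<tau>. P n \<tau>"
      unfolding P_def by (intro log_gap_potential) auto
    then show ?case
      unfolding \<tau>_def by (rule someI_ex)
  qed
  have "(\<lambda>n. pi\<^sup>2 / (log_gap n (J n) * (real n + 1 / 2))\<^sup>2) \<longlonglongrightarrow> pi\<^sup>2 / pi\<^sup>2"
    by (intro tendsto_intros lim) simp
  moreover have "\<forall>\<^sub>F n in sequentially.
      pi\<^sup>2 / (log_gap n (J n) * (real n + 1 / 2))\<^sup>2 = scaled_potential (\<tau> n)"
    using P J
  proof eventually_elim
    case (elim n)
    then have "log_gap n (J n) * (real n + 1 / 2) \<noteq> 0"
      using log_gap_pos[of "J n" n] by simp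
    then show ?case
      using elim by (simp add: P_def field_simps)
  qed
  ultimately have sp: "(\<lambda>n. scaled_potential (\<tau> n)) \<longlonglongrightarrow> 1"
    by (simp add: tendsto_cong)
  have "(\<lambda>n. sqrt (4 * (1 - scaled_potential (\<tau> n)))) \<longlonglongrightarrow> sqrt (4 * (1 - 1))"
    by (intro tendsto_intros sp)
  then have "(\<lambda>n. \<bar>\<tau> n - 2\<bar>) \<longlonglongrightarrow> 0"
    by (simp add: scaled_potential_eq)
  then have \<tau>: "\<tau> \<longlonglongrightarrow> 2"
    by (simp add: tendsto_rabs_zero_iff LIM_zero_iff)
  have "(\<lambda>n. exp (- log_gap n (J n))) \<longlonglongrightarrow> exp (- 0)"
    by (intro tendsto_intros log_gap_tendsto_0[OF lim])
  from tendsto_mult[OF \<tau> this] have low: "(\<lambda>n. \<tau> n * exp (- log_gap n (J n))) \<longlonglongrightarrow> 2"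
    by simp
  show 1: "(\<lambda>n. scaled_zero n (J n)) \<longlonglongrightarrow> 2"
  proof (rule tendsto_sandwich[OF _ _ low \<tau>])
    show "\<forall>\<^sub>F n in sequentially. \<tau> n * exp (- log_gap n (J n)) \<le> scaled_zero n (J n)"
      using P J
    proof eventually_elim
      case (elim n)
      then have "\<tau> n \<le> scaled_zero n (J n) * exp (log_gap n (J n))"
        using scaled_zero_Suc[of "J n" n] by (simp add: P_def)
      then show ?case by (simp add: exp_minus field_simps)
    qed
    show "\<forall>\<^sub>F n in sequentially. scaled_zero n (J n) \<le> \<tau> n"
      using P by eventually_elim (simp add: P_def)
  qed
  have "(\<lambda>n. scaled_zero n (J n) * exp (log_gap n (J n))) \<longlonglongrightarrow> 2 * exp 0"
    by (intro tendsto_intros 1 log_gap_tendsto_0[OF lim])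
  moreover have "\<forall>\<^sub>F n in sequentially.
      scaled_zero n (J n) * exp (log_gap n (J n)) = scaled_zero n (J n + 1)"
    using J by eventually_elim (simp add: scaled_zero_Suc[symmetric, simplified])
  ultimately show "(\<lambda>n. scaled_zero n (J n + 1)) \<longlonglongrightarrow> 2"
    by (simp add: tendsto_cong)
qed

lemma exp_minus_1_over_tendsto:
  fixes f :: "nat \<Rightarrow> real"
  assumes "f \<longlonglongrightarrow> 0" "\<forall>\<^sub>F n in sequentially. f n \<noteq> 0"
  shows "(\<lambda>n. (exp (f n) - 1) / f n) \<longlonglongrightarrow> 1"
proof -
  have "((\<lambda>x::real. (exp x - 1) / x) \<longlongrightarrow> 1) (at 0)"
    using DERIV_exp[of "0::real"] by (simp add: DERIV_def)
  moreover have "filterlim f (at 0) sequentially"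
    using assms by (simp add: filterlim_at)
  ultimately show ?thesis
    by (rule filterlim_compose)
qed

text \<open>The gap is the product of the scaled zero, (exp \<delta> - 1) / \<delta> and \<delta> (n
  + 1/2), with limits 2, 1 and \<pi>.\<close>

lemma laguerre_gap_tendsto:
  assumes J: "\<forall>\<^sub>F n in sequentially. 1 \<le> J n \<and> J n < n"
    and lim: "(\<lambda>n. log_gap n (J n) * (real n + 1 / 2)) \<longlonglongrightarrow> pi"
  shows "(\<lambda>n. laguerre_zero (J n + 1) n - laguerre_zero (J n) n) \<longlonglongrightarrow> 2 * pi"
proof -
  have "\<forall>\<^sub>F n in sequentially. log_gap n (J n) \<noteq> 0"
    using J by eventually_elim (use log_gap_pos in force)
  then have e: "(\<lambda>n. (exp (log_gap n (J n)) - 1) / log_gap n (J n)) \<longlonglongrightarrow> 1"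
    by (intro exp_minus_1_over_tendsto log_gap_tendsto_0[OF lim])
  have "(\<lambda>n. scaled_zero n (J n) * ((exp (log_gap n (J n)) - 1) / log_gap n (J n)) *
      (log_gap n (J n) * (real n + 1 / 2))) \<longlonglongrightarrow> 2 * 1 * pi"
    by (intro tendsto_mult e lim scaled_zero_tendsto_2(1)[OF J lim])
  moreover have "\<forall>\<^sub>F n in sequentially. scaled_zero n (J n) *
      ((exp (log_gap n (J n)) - 1) / log_gap n (J n)) * (log_gap n (J n) * (real n + 1 / 2))
      = laguerre_zero (J n + 1) n - laguerre_zero (J n) n"
    using J
  proof eventually_elim
    case (elim n)
    define \<nu> where "\<nu> = real n + 1 / 2"
    have \<nu>: "\<nu> > 0" by (simp add: \<nu>_def)
    have "log_gap n (J n) \<noteq> 0"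
      using log_gap_pos[of "J n" n] elim by simp
    then have "scaled_zero n (J n) * ((exp (log_gap n (J n)) - 1) / log_gap n (J n)) *
        (log_gap n (J n) * \<nu>) = (scaled_zero n (J n) * exp (log_gap n (J n)) - scaled_zero n (J n)) * \<nu>"
      by (simp add: field_simps)
    also have "\<dots> = (scaled_zero n (J n + 1) - scaled_zero n (J n)) * \<nu>"
      using elim by (simp only: scaled_zero_Suc)
    also have "\<dots> = laguerre_zero (J n + 1) n - laguerre_zero (J n) n"
      using \<nu> by (simp add: scaled_zero_def diff_divide_distrib[symmetric] flip: \<nu>_def)
    finally show ?case by (simp add: \<nu>_def)
  qed
  ultimately show ?thesis
    by (simp add: tendsto_cong)
qed

text \<open>A squeeze: \<pi> bounds every gap from below, and \<delta> / 2 <= sinh (\<delta> / 2)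
  bounds it from above through the gap ratio.\<close>

lemma log_gap_tendsto_pi:
  assumes J: "\<forall>\<^sub>F n in sequentially. 1 \<le> J n \<and> J n < n"
    and lim: "(\<lambda>n. gap_ratio n (J n) * (real n + 1 / 2)\<^sup>2) \<longlonglongrightarrow> (pi / 2)\<^sup>2"
  shows "(\<lambda>n. log_gap n (J n) * (real n + 1 / 2)) \<longlonglongrightarrow> pi"
proof (rule tendsto_sandwich)
  show "\<forall>\<^sub>F n in sequentially. pi \<le> log_gap n (J n) * (real n + 1 / 2)"
    using J by eventually_elim (simp add: log_gap_ge)
  show "\<forall>\<^sub>F n in sequentially. log_gap n (J n) * (real n + 1 / 2)
      \<le> 2 * sqrt (gap_ratio n (J n) * (real n + 1 / 2)\<^sup>2)"
    using J
  proof eventually_elim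
    case (elim n)
    then have "log_gap n (J n) * (real n + 1 / 2) / 2 \<le> sqrt (gap_ratio n (J n) * (real n + 1 / 2)\<^sup>2)"
      using gap_ratio_ge[of "J n" n] by (intro real_le_rsqrt) auto
    then show ?case by simp
  qed
  have "(\<lambda>n. 2 * sqrt (gap_ratio n (J n) * (real n + 1 / 2)\<^sup>2)) \<longlonglongrightarrow> 2 * sqrt ((pi / 2)\<^sup>2)"
    by (intro tendsto_intros lim)
  then show "(\<lambda>n. 2 * sqrt (gap_ratio n (J n) * (real n + 1 / 2)\<^sup>2)) \<longlonglongrightarrow> pi"
    by simp
qed simp

section \<open>The pair of zeros around the peak of the potential, and the minimal gap ratio\<close>

definition near_2_index :: "nat \<Rightarrow> nat" where
  "near_2_index n = Max {j \<in> {1..n}. scaled_zero n j \<le> 2}"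

text \<open>The last scaled zero up to 2 and its successor straddle 2. For large n there are zeros
  in (2 - e, 2) and in (2, 2 + e), which trap this pair.\<close>

lemma near_2_index:
  assumes "e > 0" "e < 1"
  shows "\<forall>\<^sub>F n in sequentially. 1 \<le> near_2_index n \<and> near_2_index n < n \<and>
    2 - e < scaled_zero n (near_2_index n) \<and> scaled_zero n (near_2_index n + 1) < 2 + e"
proof -
  have "\<forall>\<^sub>F n in sequentially. \<exists>i. 1 \<le> i \<and> i \<le> n \<and> 2 - e < scaled_zero n i \<and> scaled_zero n i < 2"
    using assms by (intro eventually_scaled_zero_between) auto
  moreover have "\<forall>\<^sub>F n in sequentially. \<exists>k. 1 \<le> k \<and> k \<le> n \<and> 2 < scaled_zero n k \<and> scaled_zero n k < 2 + e"
    using assms by (intro eventually_scaled_zero_between) auto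
  ultimately show ?thesis
  proof eventually_elim
    case (elim n)
    obtain i where i: "1 \<le> i" "i \<le> n" "2 - e < scaled_zero n i" "scaled_zero n i < 2"
      using elim by blast
    obtain k where k: "1 \<le> k" "k \<le> n" "2 < scaled_zero n k" "scaled_zero n k < 2 + e"
      using elim by blast
    define A where "A = {j \<in> {1..n}. scaled_zero n j \<le> 2}"
    define J where "J = Max A"
    have "finite A" "i \<in> A" using i by (auto simp: A_def)
    then have J: "J \<in> A" "i \<le> J"
      unfolding J_def by (auto intro!: Max_in)
    then have J': "1 \<le> J" "J \<le> n" "scaled_zero n J \<le> 2" by (auto simp: A_def)
    have "scaled_zero n i \<le> scaled_zero n J"
      using i J J' by (simp add: scaled_zero_le_iff)
    moreover have "J < k"
      using scaled_zero_less_iff[of J n k] J' k by simp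
    then have "scaled_zero n (J + 1) \<le> scaled_zero n k"
      using J' k by (simp add: scaled_zero_le_iff)
    ultimately show ?case
      using i k J' \<open>J < k\<close> unfolding near_2_index_def A_def[symmetric] J_def[symmetric] by simp
  qed
qed

lemma near_2_index_range: "\<forall>\<^sub>F n in sequentially. 1 \<le> near_2_index n \<and> near_2_index n < n"
  using near_2_index[of "1 / 2"] by (auto elim: eventually_mono)

text \<open>The intermediate point is within e of 2, where the potential is at least 1 - e^2 / 4.
  With the universal lower bound this gives \<delta> (n + 1/2) -> \<pi>, and sinh (\<delta> / 2)
  behaves like \<delta> / 2.\<close>

lemma near_2_index_gap_ratio:
  "(\<lambda>n. gap_ratio n (near_2_index n) * (real n + 1 / 2)\<^sup>2) \<longlonglongrightarrow> (pi / 2)\<^sup>2"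
proof -
  let ?\<delta> = "\<lambda>n. log_gap n (near_2_index n)"
  have lim: "(\<lambda>n. ?\<delta> n * (real n + 1 / 2)) \<longlonglongrightarrow> pi"
  proof (rule order_tendstoI)
    fix a :: real assume "a < pi"
    show "\<forall>\<^sub>F n in sequentially. a < ?\<delta> n * (real n + 1 / 2)"
      using near_2_index_range
    proof eventually_elim
      case (elim n)
      then show ?case
        using log_gap_ge[of "near_2_index n" n] \<open>a < pi\<close> by linarith
    qed
  next
    fix a :: real assume "pi < a"
    have "((\<lambda>e. pi / sqrt (1 - e\<^sup>2 / 4)) \<longlongrightarrow> pi / sqrt (1 - 0\<^sup>2 / 4)) (at_right 0)"
      by (intro tendsto_intros) auto
    then have "\<forall>\<^sub>F e in at_right 0. pi / sqrt (1 - e\<^sup>2 / 4) < a"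
      using \<open>pi < a\<close> by (intro order_tendstoD(2)) auto
    moreover have "\<forall>\<^sub>F e in at_right (0::real). e \<in> {0<..<1}"
      by (rule eventually_at_right_real) simp
    ultimately have "\<forall>\<^sub>F e in at_right 0. pi / sqrt (1 - e\<^sup>2 / 4) < a \<and> e \<in> {0<..<1}"
      by (rule eventually_conj)
    then obtain e where e: "0 < e" "e < 1" "pi / sqrt (1 - e\<^sup>2 / 4) < a"
      using eventually_happens'[OF trivial_limit_at_right_real] by force
    have e2: "1 - e\<^sup>2 / 4 > 0"
      using e power_strict_mono[of e 1 2] by simp
    show "\<forall>\<^sub>F n in sequentially. ?\<delta> n * (real n + 1 / 2) < a"
      using near_2_index[OF e(1,2)]
    proof eventually_elim
      case (elim n)
      obtain \<tau> where \<tau>: "scaled_zero n (near_2_index n) < \<tau>" "\<tau> < scaled_zero n (near_2_index n + 1)"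
        "(?\<delta> n * (real n + 1 / 2))\<^sup>2 * scaled_potential \<tau> = pi\<^sup>2"
        using log_gap_potential[of "near_2_index n" n] elim by blast
      have "\<bar>\<tau> - 2\<bar> \<le> \<bar>e\<bar>"
        using elim \<tau> e by (simp add: abs_le_iff)
      then have "1 - e\<^sup>2 / 4 \<le> scaled_potential \<tau>"
        unfolding scaled_potential_eq abs_le_square_iff by simp
      then have "(?\<delta> n * (real n + 1 / 2))\<^sup>2 * (1 - e\<^sup>2 / 4) \<le> pi\<^sup>2"
        unfolding \<tau>(3)[symmetric] by (intro mult_left_mono) auto
      then have "(?\<delta> n * (real n + 1 / 2))\<^sup>2 \<le> (pi / sqrt (1 - e\<^sup>2 / 4))\<^sup>2"
        using e2 by (simp add: power_divide pos_le_divide_eq)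
      then have "?\<delta> n * (real n + 1 / 2) \<le> pi / sqrt (1 - e\<^sup>2 / 4)"
        by (rule power2_le_imp_le) (use e2 in simp)
      then show ?case using e(3) by simp
    qed
  qed
  define \<epsilon> where "\<epsilon> = ?\<delta>"
  have nz: "\<forall>\<^sub>F n in sequentially. \<epsilon> n \<noteq> 0"
    using near_2_index_range by eventually_elim (use log_gap_pos in \<open>force simp: \<epsilon>_def\<close>)
  have \<epsilon>0: "\<epsilon> \<longlonglongrightarrow> 0"
    unfolding \<epsilon>_def by (rule log_gap_tendsto_0[OF lim])
  \<comment> \<open>This product is sinh (\<epsilon> / 2) (n + 1/2), split into factors with known
    limits.\<close>
  have "(\<lambda>n. exp (- \<epsilon> n / 2) * ((exp (\<epsilon> n) - 1) / \<epsilon> n) / 2 * (\<epsilon> n * (real n + 1 / 2)))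
      \<longlonglongrightarrow> exp (- 0 / 2) * 1 / 2 * pi"
    using lim unfolding \<epsilon>_def[symmetric]
    by (intro tendsto_intros \<epsilon>0 exp_minus_1_over_tendsto nz) (auto simp: \<epsilon>_def)
  then have "(\<lambda>n. (exp (- \<epsilon> n / 2) * ((exp (\<epsilon> n) - 1) / \<epsilon> n) / 2 * (\<epsilon> n * (real n + 1 / 2)))\<^sup>2)
      \<longlonglongrightarrow> (pi / 2)\<^sup>2"
    by (intro tendsto_power) simp
  moreover have "\<forall>\<^sub>F n in sequentially.
      (exp (- \<epsilon> n / 2) * ((exp (\<epsilon> n) - 1) / \<epsilon> n) / 2 * (\<epsilon> n * (real n + 1 / 2)))\<^sup>2
      = gap_ratio n (near_2_index n) * (real n + 1 / 2)\<^sup>2"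
    using nz near_2_index_range
  proof eventually_elim
    case (elim n)
    have "exp (- \<epsilon> n / 2) * exp (\<epsilon> n) = exp (\<epsilon> n / 2)"
      by (simp flip: exp_add)
    then have "exp (- \<epsilon> n / 2) * (exp (\<epsilon> n) - 1) / 2 = sinh (\<epsilon> n / 2)"
      by (simp add: sinh_field_def right_diff_distrib)
    then have "exp (- \<epsilon> n / 2) * ((exp (\<epsilon> n) - 1) / \<epsilon> n) / 2 * (\<epsilon> n * (real n + 1 / 2))
        = sinh (\<epsilon> n / 2) * (real n + 1 / 2)"
      using elim by (simp flip: times_divide_eq_right)
    then show ?case
      using elim by (simp add: gap_ratio_eq_sinh power_mult_distrib \<epsilon>_def)
  qed
  ultimately show ?thesis
    by (simp add: tendsto_cong)
qed

text \<open>The uniform lower bound on gaps bounds the minimum from below; the pair around 2 is the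
  trial index that matches it in the limit.\<close>

lemma gap_ratio_min_tendsto:
  "(\<lambda>n. Min (gap_ratio n ` {1..<n}) * (real n + 1 / 2)\<^sup>2) \<longlonglongrightarrow> (pi / 2)\<^sup>2"
proof (rule tendsto_sandwich[OF _ _ tendsto_const near_2_index_gap_ratio])
  show "\<forall>\<^sub>F n in sequentially. (pi / 2)\<^sup>2 \<le> Min (gap_ratio n ` {1..<n}) * (real n + 1 / 2)\<^sup>2"
    using eventually_ge_at_top[of 2]
  proof eventually_elim
    case (elim n)
    then have "Min (gap_ratio n ` {1..<n}) \<in> gap_ratio n ` {1..<n}"
      by (intro Min_in) auto
    then obtain j where j: "1 \<le> j" "j < n" "Min (gap_ratio n ` {1..<n}) = gap_ratio n j"
      by auto
    have "(pi / 2)\<^sup>2 \<le> (log_gap n j * (real n + 1 / 2) / 2)\<^sup>2"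
      using log_gap_ge[OF j(1,2)] by (intro power_mono divide_right_mono) auto
    also have "\<dots> \<le> gap_ratio n j * (real n + 1 / 2)\<^sup>2"
      by (rule gap_ratio_ge[OF j(1,2)])
    finally show ?case unfolding j(3) .
  qed
  show "\<forall>\<^sub>F n in sequentially. Min (gap_ratio n ` {1..<n}) * (real n + 1 / 2)\<^sup>2
      \<le> gap_ratio n (near_2_index n) * (real n + 1 / 2)\<^sup>2"
    using near_2_index_range by eventually_elim (auto intro!: mult_right_mono Min_le)
qed

section \<open>Limits for the minimisers and for the optimal variance\<close>

lemma argmin_gap_limits:
  assumes j: "\<And>m. j m \<in> {1..m + 1}"
    and min: "\<And>m. gap_ratio (m + 2) (j m) = Min (gap_ratio (m + 2) ` {1..<m + 2})"
  shows "(\<lambda>m. laguerre_zero (j m) (m + 2) / real (m + 2)) \<longlonglongrightarrow> 2" (is ?A)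
    and "(\<lambda>m. laguerre_zero (j m + 1) (m + 2) / real (m + 2)) \<longlonglongrightarrow> 2" (is ?B)
    and "(\<lambda>m. laguerre_zero (j m + 1) (m + 2) - laguerre_zero (j m) (m + 2)) \<longlonglongrightarrow> 2 * pi" (is ?C)
    and "(\<lambda>m. real (j m) / real (m + 2)) \<longlonglongrightarrow> 1 / 2 + 1 / pi" (is ?D)
proof -
  \<comment> \<open>Reindexing by n = m + 2. Truncated subtraction differs only for n < 2, which
    statements for large n ignore.\<close>
  define J where "J = (\<lambda>n. j (n - 2))"
  have J: "\<forall>\<^sub>F n in sequentially. 1 \<le> J n \<and> J n < n"
    using eventually_ge_at_top[of 2]
  proof eventually_elim
    case (elim n)
    then show ?case
      using j[of "n - 2"] unfolding J_def atLeastAtMost_iff by arith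
  qed
  have "\<forall>\<^sub>F n in sequentially. Min (gap_ratio n ` {1..<n}) * (real n + 1 / 2)\<^sup>2
      = gap_ratio n (J n) * (real n + 1 / 2)\<^sup>2"
    using eventually_ge_at_top[of 2]
  proof eventually_elim
    case (elim n)
    then have "n - 2 + 2 = n" by simp
    then show ?case using min[of "n - 2"] by (simp only: J_def)
  qed
  then have "(\<lambda>n. gap_ratio n (J n) * (real n + 1 / 2)\<^sup>2) \<longlonglongrightarrow> (pi / 2)\<^sup>2"
    by (rule Lim_transform_eventually[OF gap_ratio_min_tendsto])
  then have lim: "(\<lambda>n. log_gap n (J n) * (real n + 1 / 2)) \<longlonglongrightarrow> pi"
    by (rule log_gap_tendsto_pi[OF J])
  note z = scaled_zero_tendsto_2[OF J lim]
  have scale: "(\<lambda>n. (real n + 1 / 2) / real n) \<longlonglongrightarrow> 1"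
    by real_asymp
  have rescale: "(\<lambda>n. f n / real n) \<longlonglongrightarrow> L" if "(\<lambda>n. f n / (real n + 1 / 2)) \<longlonglongrightarrow> L" for f :: "nat \<Rightarrow> real" and L
  proof -
    have "(\<lambda>n. f n / (real n + 1 / 2) * ((real n + 1 / 2) / real n)) \<longlonglongrightarrow> L"
      using tendsto_mult[OF that scale] by simp
    moreover have "f n / (real n + 1 / 2) * ((real n + 1 / 2) / real n) = f n / real n" for n
    proof -
      have "real n + 1 / 2 \<noteq> 0" by linarith
      then show ?thesis by (simp del: of_nat_eq_0_iff)
    qed
    ultimately show ?thesis by simp
  qed
  have shift: "(\<lambda>m. f (m + 2)) \<longlonglongrightarrow> L" if "f \<longlonglongrightarrow> L" for f :: "nat \<Rightarrow> real" and L
    using that by (rule LIMSEQ_ignore_initial_segment)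
  show ?A ?B
    using shift[OF rescale[OF z(1)[unfolded scaled_zero_def]]]
      shift[OF rescale[OF z(2)[unfolded scaled_zero_def]]] by (simp_all add: J_def)
  show ?C
    using shift[OF laguerre_gap_tendsto[OF J lim]] by (simp add: J_def)
  have "\<forall>\<^sub>F n in sequentially. 1 \<le> J n \<and> J n \<le> n"
    using J by eventually_elim simp
  from zero_index_tendsto[OF this z(1)] have "(\<lambda>n. real (J n) / (real n + 1 / 2)) \<longlonglongrightarrow> arc_count 2 / pi" .
  moreover have "arc_count 2 / pi = 1 / 2 + 1 / pi"
    by (simp add: arc_count_values add_divide_distrib)
  ultimately have "(\<lambda>n. real (J n) / (real n + 1 / 2)) \<longlonglongrightarrow> 1 / 2 + 1 / pi"
    by simp
  from shift[OF rescale[OF this]] show ?D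
    by (simp add: J_def)
qed

text \<open>Replacing the scale m + 5/2, which is n + 1/2 at n = m + 2, by m costs a factor tending
  to 1.\<close>

lemma opt_variance_tendsto: "(\<lambda>m. (real m)\<^sup>2 * opt_variance m) \<longlonglongrightarrow> (pi / 2)\<^sup>2"
proof -
  have "(\<lambda>m. opt_variance m * (real (m + 2) + 1 / 2)\<^sup>2) \<longlonglongrightarrow> (pi / 2)\<^sup>2"
    unfolding opt_variance_eq_Min
    using gap_ratio_min_tendsto by (rule LIMSEQ_ignore_initial_segment)
  moreover have "(\<lambda>m. (real m / (real (m + 2) + 1 / 2))\<^sup>2) \<longlonglongrightarrow> 1"
    by real_asymp
  ultimately have "(\<lambda>m. opt_variance m * (real (m + 2) + 1 / 2)\<^sup>2 *
      (real m / (real (m + 2) + 1 / 2))\<^sup>2) \<longlonglongrightarrow> (pi / 2)\<^sup>2 * 1"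
    by (rule tendsto_mult)
  moreover have "opt_variance m * (real (m + 2) + 1 / 2)\<^sup>2 * (real m / (real (m + 2) + 1 / 2))\<^sup>2
      = (real m)\<^sup>2 * opt_variance m" for m
  proof -
    have "real (m + 2) + 1 / 2 \<noteq> 0" by linarith
    then show ?thesis by (simp add: power_divide)
  qed
  ultimately show ?thesis by (simp only: mult_1_right)
qed

theorem corollary8p2:
  shows "(\<forall>m. opt_variance m = Min (gap_ratio (m + 2) ` {1..<m + 2})) \<and>
    (\<lambda>m. opt_variance m - pi\<^sup>2 / (4 * (real m)\<^sup>2)) \<in> o(\<lambda>m. 1 / (real m)\<^sup>2) \<and>
    (\<lambda>m. (2 * real m + 1)\<^sup>2 * opt_variance m) \<longlonglongrightarrow> pi\<^sup>2 \<and>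
    (\<forall>j :: nat \<Rightarrow> nat.
       (\<forall>m. j m \<in> {1..m + 1} \<and>
            gap_ratio (m + 2) (j m) = Min (gap_ratio (m + 2) ` {1..<m + 2})) \<longrightarrow>
       (\<lambda>m. laguerre_zero (j m) (m + 2) / real (m + 2)) \<longlonglongrightarrow> 2 \<and>
       (\<lambda>m. laguerre_zero (j m + 1) (m + 2) / real (m + 2)) \<longlonglongrightarrow> 2 \<and>
       (\<lambda>m. laguerre_zero (j m + 1) (m + 2) - laguerre_zero (j m) (m + 2)) \<longlonglongrightarrow> 2 * pi \<and>
       (\<lambda>m. real (j m) / real (m + 2)) \<longlonglongrightarrow> 1 / 2 + 1 / pi)"
proof (intro conjI allI impI)
  show "opt_variance m = Min (gap_ratio (m + 2) ` {1..<m + 2})" for m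
    by (rule opt_variance_eq_Min)
  have nz: "\<forall>\<^sub>F m in sequentially. real m \<noteq> 0"
    using eventually_gt_at_top[of 0] by eventually_elim simp
  show "(\<lambda>m. opt_variance m - pi\<^sup>2 / (4 * (real m)\<^sup>2)) \<in> o(\<lambda>m. 1 / (real m)\<^sup>2)"
  proof (rule smalloI_tendsto)
    have "(\<lambda>m. (real m)\<^sup>2 * opt_variance m - (pi / 2)\<^sup>2) \<longlonglongrightarrow> 0"
      using opt_variance_tendsto by (rule LIM_zero)
    moreover have "\<forall>\<^sub>F m in sequentially. (real m)\<^sup>2 * opt_variance m - (pi / 2)\<^sup>2
        = (opt_variance m - pi\<^sup>2 / (4 * (real m)\<^sup>2)) / (1 / (real m)\<^sup>2)"
      using nz by eventually_elim (simp add: power_divide field_simps)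
    ultimately show "(\<lambda>m. (opt_variance m - pi\<^sup>2 / (4 * (real m)\<^sup>2)) / (1 / (real m)\<^sup>2)) \<longlonglongrightarrow> 0"
      by (simp add: tendsto_cong)
  qed (use nz in eventually_elim, simp)
  have "(\<lambda>m. ((2 * real m + 1) / real m)\<^sup>2) \<longlonglongrightarrow> 2\<^sup>2"
    by real_asymp
  from tendsto_mult[OF this opt_variance_tendsto]
  have "(\<lambda>m. ((2 * real m + 1) / real m)\<^sup>2 * ((real m)\<^sup>2 * opt_variance m)) \<longlonglongrightarrow> pi\<^sup>2"
    by (simp add: power_divide)
  moreover have "\<forall>\<^sub>F m in sequentially. ((2 * real m + 1) / real m)\<^sup>2 * ((real m)\<^sup>2 * opt_variance m)
      = (2 * real m + 1)\<^sup>2 * opt_variance m"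
    using nz by eventually_elim (simp add: power_divide)
  ultimately show "(\<lambda>m. (2 * real m + 1)\<^sup>2 * opt_variance m) \<longlonglongrightarrow> pi\<^sup>2"
    by (rule Lim_transform_eventually)
next
  fix j :: "nat \<Rightarrow> nat"
  assume "\<forall>m. j m \<in> {1..m + 1} \<and>
    gap_ratio (m + 2) (j m) = Min (gap_ratio (m + 2) ` {1..<m + 2})"
  then have j: "\<And>m. j m \<in> {1..m + 1}"
    "\<And>m. gap_ratio (m + 2) (j m) = Min (gap_ratio (m + 2) ` {1..<m + 2})"
    by blast+
  note lims = argmin_gap_limits[of j, OF j]
  show "(\<lambda>m. laguerre_zero (j m) (m + 2) / real (m + 2)) \<longlonglongrightarrow> 2"
    by (rule lims(1))
  show "(\<lambda>m. laguerre_zero (j m + 1) (m + 2) / real (m + 2)) \<longlonglongrightarrow> 2"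
    by (rule lims(2))
  show "(\<lambda>m. laguerre_zero (j m + 1) (m + 2) - laguerre_zero (j m) (m + 2)) \<longlonglongrightarrow> 2 * pi"
    by (rule lims(3))
  show "(\<lambda>m. real (j m) / real (m + 2)) \<longlonglongrightarrow> 1 / 2 + 1 / pi"
    by (rule lims(4))
qed

end
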